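(* Let $A$ be an abelian group and $n\ge0$. The simplicial abelian group $K^\ast\mathcal D_n(A)$ is isomorphic to $$\bigoplus_{k=0}^{n-1}E(A,k)\oplus K(A,n),$$ where $K(A,n)$ is the $n$-th Eilenberg–Mac Lane space of $A$ and each $E(A,k)$, $0\le k\le n-1$, is a contractible simplicial abelian group.
   Context: For an abelian group $A$ and $n\ge0$, $\mathcal D_n(A)$ is the concrete cubeset (abelian cubegroup) $\mathrm{HK}(A_\bullet)$ for the filtration $A_0=\dots=A_n=A$, $A_j=0$ for $j>n$: its $m$-cubes are the maps $c\colon\{0,1\}^m\to A$ of the form $c(x)=\sum_{S\subseteq\{0,\dots,m-1\},\,|S|\le n}a_S\prod_{i\in S}x_i$ with $a_S\in A$, with pointwise addition. $K(A,n)$ is the simplicial abelian group corresponding under Dold–Kan to the chain complex with $A$ in degree $n$ and $0$ elsewhere. The category $\square$ has objects $\{0,1\}^n$, $n\ge 0$, and morphisms the maps $\{0,1\}^n\to\{0,1\}^m$ that are restrictions of affine linear maps $\mathbb Z^n\to\mathbb Z^m$. A cubeset is a presheaf of sets on $\square$. $\mathrm{Sub}[n]$ denotes the set of nonempty subsets of $\{0,\dots,n\}$; $\Delta$ is the simplex category; $\sigma\colon[k]\to[n]$ in $\Delta$ induces $\sigma_\ast\colon\mathrm{Sub}[k]\to\mathrm{Sub}[n]$ by direct image. A formal $k$-cube with labels in $[k]$ is a map $B\colon\{0,1\}^k\to\mathrm{Sub}[k]$. It is degenerable if for every $0\le i<k$, $\sigma_{i,\ast}\circ B$ does not depend on the coordinate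 $x_i$, where $\sigma_i\colon[k]\to[k-1]$ is the degeneracy identifying $i$ and $i+1$ (coordinates are $x_0,\dots,x_{k-1}$). Let $K_n(m)$ be the set of all composites $\sigma_\ast\circ B\circ\phi\colon\{0,1\}^m\to\mathrm{Sub}[n]$ with $\phi\colon\{0,1\}^m\to\{0,1\}^k$ in $\square$, $B$ a degenerable formal $k$-cube, $\sigma\colon[k]\to[n]$ in $\Delta$, $k\ge0$; this is a cosimplicial cubeset. For a cubeset $X$, $K^\ast X$ is the simplicial set $[n]\mapsto\mathrm{Hom}(K_n,X)$ (Hom of cubesets). For an abelian group object $X$ this is a simplicial abelian group. *)

theory Defs
  imports "HOL-Algebra.Product_Groups" "HOL-Algebra.FiniteProduct"
begin

section \<open>The cube category and cubesets\<close>

text \<open>Points of the discrete cube are functions that are undefined outside the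
  coordinates \<open>0, \<dots>, n - 1\<close>, so that equality of points is equality of functions; the same
  convention is used for all maps below.\<close>

definition cube :: "nat \<Rightarrow> (nat \<Rightarrow> int) set" where
  "cube n = {..<n} \<rightarrow>\<^sub>E {0, 1}"

definition box_hom :: "nat \<Rightarrow> nat \<Rightarrow> ((nat \<Rightarrow> int) \<Rightarrow> (nat \<Rightarrow> int)) set" where
  "box_hom m n = {\<phi> \<in> cube m \<rightarrow>\<^sub>E cube n.
     \<exists>(b :: nat \<Rightarrow> int) (M :: nat \<Rightarrow> nat \<Rightarrow> int).
       \<forall>x\<in>cube m. \<forall>j<n. \<phi> x j = b j + (\<Sum>i<m. M j i * x i)}"

text \<open>\<open>restr X m n \<phi>\<close> is the map \<open>X(n) \<rightarrow> X(m)\<close> induced by \<open>\<phi> : {0,1}\<^sup>m \<rightarrow> {0,1}\<^sup>n\<close>.\<close>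

record 'c cubeset =
  cubes :: "nat \<Rightarrow> 'c set"
  restr :: "nat \<Rightarrow> nat \<Rightarrow> ((nat \<Rightarrow> int) \<Rightarrow> (nat \<Rightarrow> int)) \<Rightarrow> 'c \<Rightarrow> 'c"

definition is_cubeset :: "('c, 'e) cubeset_scheme \<Rightarrow> bool" where
  "is_cubeset X \<longleftrightarrow>
     (\<forall>m n. \<forall>\<phi>\<in>box_hom m n. restr X m n \<phi> \<in> cubes X n \<rightarrow> cubes X m) \<and>
     (\<forall>n. \<forall>c\<in>cubes X n. restr X n n (\<lambda>x\<in>cube n. x) c = c) \<and>
     (\<forall>l m n. \<forall>\<phi>\<in>box_hom l m. \<forall>\<psi>\<in>box_hom m n. \<forall>c\<in>cubes X n.
        restr X l n (compose (cube l) \<psi> \<phi>) c = restr X l m \<phi> (restr X m n \<psi> c))"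

definition cubeset_hom ::
    "('c, 'e) cubeset_scheme \<Rightarrow> ('d, 'f) cubeset_scheme \<Rightarrow> (nat \<Rightarrow> 'c \<Rightarrow> 'd) set" where
  "cubeset_hom X Y = {F.
     (\<forall>m. F m \<in> cubes X m \<rightarrow>\<^sub>E cubes Y m) \<and>
     (\<forall>m n. \<forall>\<phi>\<in>box_hom m n. \<forall>c\<in>cubes X n.
        F m (restr X m n \<phi> c) = restr Y m n \<phi> (F n c))}"

text \<open>A cubeset with a group structure on each set of cubes.\<close>

record 'c cubegroup = "'c cubeset" +
  cmult :: "nat \<Rightarrow> 'c \<Rightarrow> 'c \<Rightarrow> 'c"
  cone :: "nat \<Rightarrow> 'c"

definition level :: "('c, 'e) cubegroup_scheme \<Rightarrow> nat \<Rightarrow> 'c monoid" where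
  "level X m = \<lparr>carrier = cubes X m, monoid.mult = cmult X m, one = cone X m\<rparr>"

definition is_abelian_cubegroup :: "('c, 'e) cubegroup_scheme \<Rightarrow> bool" where
  "is_abelian_cubegroup X \<longleftrightarrow> is_cubeset X \<and> (\<forall>m. comm_group (level X m)) \<and>
     (\<forall>m n. \<forall>\<phi>\<in>box_hom m n. restr X m n \<phi> \<in> hom (level X n) (level X m))"

text \<open>Since \<open>x\<close> is a vertex of the cube, the monomial \<open>\<Prod>i\<in>S. x i\<close> is \<open>0\<close> or \<open>1\<close>, and the
  conditional is the multiple of \<open>a S\<close> by that integer.\<close>

definition poly_cubes :: "nat \<Rightarrow> nat \<Rightarrow> ((nat \<Rightarrow> int) \<Rightarrow> 'a::ab_group_add) set" where
  "poly_cubes n m = {c. \<exists>a :: nat set \<Rightarrow> 'a. c = (\<lambda>x\<in>cube m.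
     \<Sum>S | S \<subseteq> {..<m} \<and> card S \<le> n. if (\<Prod>i\<in>S. x i) = 1 then a S else 0)}"

definition poly_cubegroup :: "nat \<Rightarrow> ((nat \<Rightarrow> int) \<Rightarrow> 'a::ab_group_add) cubegroup" where
  "poly_cubegroup n = \<lparr>
     cubes = poly_cubes n,
     restr = (\<lambda>l m \<phi> c. compose (cube l) c \<phi>),
     cmult = (\<lambda>m c c'. \<lambda>x\<in>cube m. c x + c' x),
     cone = (\<lambda>m. \<lambda>x\<in>cube m. 0)\<rparr>"


section \<open>Simplicial abelian groups\<close>

definition delta_hom :: "nat \<Rightarrow> nat \<Rightarrow> (nat \<Rightarrow> nat) set" where
  "delta_hom k n = {\<sigma> \<in> {..k} \<rightarrow>\<^sub>E {..n}. mono_on {..k} \<sigma>}"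

text \<open>\<open>sact X k n \<sigma>\<close> is the map \<open>X\<^sub>n \<rightarrow> X\<^sub>k\<close> induced by \<open>\<sigma> : [k] \<rightarrow> [n]\<close>.\<close>

record 'g simp_group =
  sgrp :: "nat \<Rightarrow> 'g monoid"
  sact :: "nat \<Rightarrow> nat \<Rightarrow> (nat \<Rightarrow> nat) \<Rightarrow> 'g \<Rightarrow> 'g"

definition simplicial_abelian_group :: "'g simp_group \<Rightarrow> bool" where
  "simplicial_abelian_group X \<longleftrightarrow>
     (\<forall>n. comm_group (sgrp X n)) \<and>
     (\<forall>k n. \<forall>\<sigma>\<in>delta_hom k n. sact X k n \<sigma> \<in> hom (sgrp X n) (sgrp X k)) \<and>
     (\<forall>n. \<forall>x\<in>carrier (sgrp X n). sact X n n (\<lambda>i\<in>{..n}. i) x = x) \<and>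
     (\<forall>k m n. \<forall>\<sigma>\<in>delta_hom k m. \<forall>\<tau>\<in>delta_hom m n. \<forall>x\<in>carrier (sgrp X n).
        sact X k n (compose {..k} \<tau> \<sigma>) x = sact X k m \<sigma> (sact X m n \<tau> x))"

definition simp_group_iso :: "'g simp_group \<Rightarrow> 'h simp_group \<Rightarrow> bool" where
  "simp_group_iso X Y \<longleftrightarrow> (\<exists>\<Phi>. (\<forall>n. \<Phi> n \<in> iso (sgrp X n) (sgrp Y n)) \<and>
     (\<forall>k n. \<forall>\<sigma>\<in>delta_hom k n. \<forall>x\<in>carrier (sgrp X n).
        \<Phi> k (sact X k n \<sigma> x) = sact Y k n \<sigma> (\<Phi> n x)))"

text \<open>A simplicial homotopy \<open>H : X \<times> \<Delta>\<^sup>1 \<rightarrow> X\<close> of maps of simplicial sets from the identity to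
  the constant map at a vertex \<open>v\<close>; an \<open>m\<close>-simplex of \<open>\<Delta>\<^sup>1\<close> is an element of
  \<open>delta_hom m 1\<close>. A simplicial abelian group is a Kan complex, so such a one-step homotopy
  exists iff \<open>X\<close> is homotopy equivalent to a point.\<close>

definition contractible :: "'g simp_group \<Rightarrow> bool" where
  "contractible X \<longleftrightarrow> (\<exists>H. \<exists>v\<in>carrier (sgrp X 0).
     (\<forall>m. \<forall>x\<in>carrier (sgrp X m). \<forall>\<tau>\<in>delta_hom m 1. H m x \<tau> \<in> carrier (sgrp X m)) \<and>
     (\<forall>k m. \<forall>\<sigma>\<in>delta_hom k m. \<forall>x\<in>carrier (sgrp X m). \<forall>\<tau>\<in>delta_hom m 1.
        H k (sact X k m \<sigma> x) (compose {..k} \<tau> \<sigma>) = sact X k m \<sigma> (H m x \<tau>)) \<and>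
     (\<forall>m. \<forall>x\<in>carrier (sgrp X m). H m x (\<lambda>i\<in>{..m}. 0) = x) \<and>
     (\<forall>m. \<forall>x\<in>carrier (sgrp X m). H m x (\<lambda>i\<in>{..m}. 1) = sact X m 0 (\<lambda>i\<in>{..m}. 0) v))"

definition simp_direct_sum :: "'i set \<Rightarrow> ('i \<Rightarrow> 'g simp_group) \<Rightarrow> ('i \<Rightarrow> 'g) simp_group" where
  "simp_direct_sum I X = \<lparr>
     sgrp = (\<lambda>m. sum_group I (\<lambda>i. sgrp (X i) m)),
     sact = (\<lambda>k m \<sigma> f. \<lambda>i\<in>I. sact (X i) k m \<sigma> (f i))\<rparr>"

definition simp_binary_sum :: "'g simp_group \<Rightarrow> 'h simp_group \<Rightarrow> ('g \<times> 'h) simp_group" where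
  "simp_binary_sum X Y = \<lparr>
     sgrp = (\<lambda>m. sgrp X m \<times>\<times> sgrp Y m),
     sact = (\<lambda>k m \<sigma>. map_prod (sact X k m \<sigma>) (sact Y k m \<sigma>))\<rparr>"


section \<open>The Dold--Kan functor and Eilenberg--Mac Lane spaces\<close>

text \<open>\<open>bd C p\<close> is the differential \<open>C\<^sub>p \<rightarrow> C\<^sub>p\<^sub>-\<^sub>1\<close>; it is only used for \<open>p \<ge> 1\<close>.\<close>

record 'a chain_complex =
  cgrp :: "nat \<Rightarrow> 'a monoid"
  bd :: "nat \<Rightarrow> 'a \<Rightarrow> 'a"

definition delta_surj :: "nat \<Rightarrow> (nat \<times> (nat \<Rightarrow> nat)) set" where
  "delta_surj m = {(p, \<eta>). \<eta> \<in> delta_hom m p \<and> \<eta> ` {..m} = {..p}}"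

text \<open>The action of an injective \<open>\<mu> : [q] \<rightarrow> [p]\<close> on \<open>C\<^sub>p\<close>, for the normalisation in which
  the normalised complex is the common kernel of all faces but \<open>d\<^sub>0\<close>, with differential
  \<open>d\<^sub>0\<close>.\<close>

definition dk_mono :: "'a chain_complex \<Rightarrow> nat \<Rightarrow> nat \<Rightarrow> (nat \<Rightarrow> nat) \<Rightarrow> 'a \<Rightarrow> 'a" where
  "dk_mono C q p \<mu> a =
     (if q = p then a
      else if p = Suc q \<and> \<mu> = (\<lambda>i\<in>{..q}. Suc i) then bd C p a
      else \<one>\<^bsub>cgrp C q\<^esub>)"

text \<open>\<open>\<Gamma>(C)\<^sub>m\<close> is the direct sum of the \<open>C\<^sub>p\<close> over all surjections \<open>\<eta> : [m] \<rightarrow> [p]\<close>. For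
  \<open>\<alpha> : [l] \<rightarrow> [m]\<close>, the summand of \<open>\<eta>\<close> is mapped to that of \<open>\<theta>\<close> by the action of \<open>\<mu>\<close>,
  where \<open>\<eta> \<circ> \<alpha> = \<mu> \<circ> \<theta>\<close> is the factorisation into a surjection and an injection.\<close>

definition dold_kan :: "'a chain_complex \<Rightarrow> (nat \<times> (nat \<Rightarrow> nat) \<Rightarrow> 'a) simp_group" where
  "dold_kan C = \<lparr>
     sgrp = (\<lambda>m. sum_group (delta_surj m) (\<lambda>(p, \<eta>). cgrp C p)),
     sact = (\<lambda>l m \<alpha> f. \<lambda>(q, \<theta>)\<in>delta_surj l.
       finprod (cgrp C q) (\<lambda>(p, \<eta>, \<mu>). dk_mono C q p \<mu> (f (p, \<eta>)))
         {(p, \<eta>, \<mu>). (p, \<eta>) \<in> delta_surj m \<and> \<mu> \<in> delta_hom q p \<and> inj_on \<mu> {..q} \<and>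
            compose {..l} \<eta> \<alpha> = compose {..l} \<mu> \<theta>})\<rparr>"

definition additive_group :: "'a::ab_group_add monoid" where
  "additive_group = \<lparr>carrier = UNIV, monoid.mult = (+), one = 0\<rparr>"

definition concentrated :: "nat \<Rightarrow> 'a::ab_group_add chain_complex" where
  "concentrated n = \<lparr>
     cgrp = (\<lambda>p. if p = n then additive_group else singleton_group 0),
     bd = (\<lambda>p a. 0)\<rparr>"

definition eilenberg_maclane :: "nat \<Rightarrow> (nat \<times> (nat \<Rightarrow> nat) \<Rightarrow> 'a::ab_group_add) simp_group" where
  "eilenberg_maclane n = dold_kan (concentrated n)"


section \<open>The functor \<open>K\<^sup>*\<close>\<close>

definition Sub :: "nat \<Rightarrow> nat set set" where
  "Sub n = {S. S \<noteq> {} \<and> S \<subseteq> {..n}}"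

definition degen :: "nat \<Rightarrow> nat \<Rightarrow> nat" where
  "degen i j = (if j \<le> i then j else j - 1)"

definition degenerable :: "nat \<Rightarrow> ((nat \<Rightarrow> int) \<Rightarrow> nat set) set" where
  "degenerable k = {B \<in> cube k \<rightarrow>\<^sub>E Sub k.
     \<forall>i<k. \<forall>x\<in>cube k. \<forall>y\<in>cube k. (\<forall>j<k. j \<noteq> i \<longrightarrow> x j = y j) \<longrightarrow>
       degen i ` B x = degen i ` B y}"

definition K_cubes :: "nat \<Rightarrow> nat \<Rightarrow> ((nat \<Rightarrow> int) \<Rightarrow> nat set) set" where
  "K_cubes n m = {c. \<exists>k. \<exists>\<phi>\<in>box_hom m k. \<exists>B\<in>degenerable k. \<exists>\<sigma>\<in>delta_hom k n.
     c = (\<lambda>x\<in>cube m. \<sigma> ` B (\<phi> x))}"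

definition K_cubeset :: "nat \<Rightarrow> ((nat \<Rightarrow> int) \<Rightarrow> nat set) cubeset" where
  "K_cubeset n = \<lparr>cubes = K_cubes n, restr = (\<lambda>l m \<phi> c. compose (cube l) c \<phi>)\<rparr>"

definition K_star :: "('c, 'e) cubegroup_scheme \<Rightarrow>
    (nat \<Rightarrow> ((nat \<Rightarrow> int) \<Rightarrow> nat set) \<Rightarrow> 'c) simp_group" where
  "K_star X = \<lparr>
     sgrp = (\<lambda>n. \<lparr>
       carrier = cubeset_hom (K_cubeset n) X,
       monoid.mult = (\<lambda>F G m. \<lambda>c\<in>K_cubes n m. cmult X m (F m c) (G m c)),
       one = (\<lambda>m. \<lambda>c\<in>K_cubes n m. cone X m)\<rparr>),
     sact = (\<lambda>k n \<sigma> F m. \<lambda>c\<in>K_cubes k m. F m (\<lambda>x\<in>cube m. \<sigma> ` c x))\<rparr>"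


subsection \<open>Well-formedness\<close>

lemma box_hom_compose:
  assumes "\<phi> \<in> box_hom l m" "\<psi> \<in> box_hom m n"
  shows "compose (cube l) \<psi> \<phi> \<in> box_hom l n"
proof -
  obtain b M where 1: "\<phi> \<in> cube l \<rightarrow>\<^sub>E cube m" "\<And>x j. x\<in>cube l \<Longrightarrow> j<m \<Longrightarrow> \<phi> x j = b j + (\<Sum>i<l. (M j i::int) * x i)"
    using assms(1) by (auto simp: box_hom_def)
  obtain b' M' where 2: "\<psi> \<in> cube m \<rightarrow>\<^sub>E cube n" "\<And>x j. x\<in>cube m \<Longrightarrow> j<n \<Longrightarrow> \<psi> x j = b' j + (\<Sum>i<m. (M' j i::int) * x i)"
    using assms(2) by (auto simp: box_hom_def)
  have mem: "\<And>x. x \<in> cube l \<Longrightarrow> \<phi> x \<in> cube m" using 1 by auto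
  have "\<psi> (\<phi> x) j = (b' j + (\<Sum>i<m. M' j i * b i)) + (\<Sum>i<l. (\<Sum>k<m. M' j k * M k i) * x i)"
    if "x \<in> cube l" "j < n" for x j
  proof -
    have "\<psi> (\<phi> x) j = b' j + (\<Sum>k<m. M' j k * (b k + (\<Sum>i<l. M k i * x i)))"
      using that mem 1(2) 2(2) by (auto intro!: sum.cong)
    also have "... = b' j + (\<Sum>k<m. M' j k * b k) + (\<Sum>k<m. \<Sum>i<l. M' j k * M k i * x i)"
      by (simp add: algebra_simps sum.distrib sum_distrib_left)
    also have "(\<Sum>k<m. \<Sum>i<l. M' j k * M k i * x i) = (\<Sum>i<l. (\<Sum>k<m. M' j k * M k i) * x i)"
      by (subst sum.swap) (simp add: sum_distrib_right)
    finally show ?thesis .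
  qed
  moreover have "compose (cube l) \<psi> \<phi> \<in> cube l \<rightarrow>\<^sub>E cube n"
    using 1 2 by (auto simp: compose_def)
  ultimately show ?thesis unfolding box_hom_def compose_def
    by (simp) (intro exI ballI allI impI, auto)
qed

lemma is_cubeset_K: "is_cubeset (K_cubeset n)"
proof -
  have A: "compose (cube l) c \<phi> \<in> K_cubes n l" if h: "\<phi> \<in> box_hom l m" "c \<in> K_cubes n m" for l m \<phi> c
  proof -
    obtain k \<psi> B \<sigma> where H: "\<psi>\<in>box_hom m k" "B\<in>degenerable k" "\<sigma>\<in>delta_hom k n" "c = (\<lambda>x\<in>cube m. \<sigma> ` B (\<psi> x))"
      using h(2) unfolding K_cubes_def by clarsimp
    have "compose (cube l) c \<phi> = (\<lambda>x\<in>cube l. \<sigma> ` B (compose (cube l) \<psi> \<phi> x))"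
      using h(1) H(4) by (auto simp: compose_def box_hom_def fun_eq_iff)
    then show ?thesis using H box_hom_compose[OF h(1) H(1)] unfolding K_cubes_def by blast
  qed
  have ident: "compose (cube m) c (\<lambda>x\<in>cube m. x) = c" if "c \<in> K_cubes n m" for c m
    using that by (auto simp: K_cubes_def compose_def cong: restrict_cong)
  have comp: "compose (cube l) c (compose (cube l) \<psi> \<phi>) = compose (cube l) (compose (cube m) c \<psi>) \<phi>"
    if "\<phi> \<in> box_hom l m" for c \<psi> \<phi> l m
    using that by (fastforce simp: compose_def box_hom_def fun_eq_iff)
  show ?thesis unfolding is_cubeset_def using A ident comp by (auto simp: K_cubeset_def)
qed

lemma K_cubes_image:
  assumes "\<sigma> \<in> delta_hom p q" "c \<in> K_cubes p m" shows "(\<lambda>x\<in>cube m. \<sigma> ` c x) \<in> K_cubes q m"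
proof -
    obtain k \<psi> B \<tau> where H: "\<psi>\<in>box_hom m k" "B\<in>degenerable k" "\<tau>\<in>delta_hom k p" "c = (\<lambda>x\<in>cube m. \<tau> ` B (\<psi> x))"
      using assms(2) unfolding K_cubes_def by clarsimp
    have d: "compose {..k} \<sigma> \<tau> \<in> delta_hom k q" using assms(1) H(3)
      by (auto simp: delta_hom_def compose_def monotone_on_def PiE_iff)
    have sub: "x \<in> cube m \<Longrightarrow> B (\<psi> x) \<subseteq> {..k}" for x
      using H by (fastforce simp: box_hom_def degenerable_def Sub_def PiE_iff)
    have "(\<lambda>x\<in>cube m. \<sigma> ` c x) = (\<lambda>x\<in>cube m. compose {..k} \<sigma> \<tau> ` B (\<psi> x))"
      using H(4) sub by (auto simp: compose_def image_image fun_eq_iff subset_iff restrict_def intro!: image_cong)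
    then show ?thesis using H d unfolding K_cubes_def by blast
qed

lemma K_cubes_Sub: "c \<in> K_cubes p m \<Longrightarrow> x \<in> cube m \<Longrightarrow> c x \<in> Sub p"
  by (fastforce simp: K_cubes_def box_hom_def degenerable_def Sub_def PiE_iff delta_hom_def)

lemma simplicial_abelian_group_K_star:
  assumes X: "is_abelian_cubegroup X"
  shows "simplicial_abelian_group (K_star X)"
proof -
  have G: "comm_group (level X m)" for m using X by (simp add: is_abelian_cubegroup_def)
  have Rh: "\<phi> \<in> box_hom l m \<Longrightarrow> restr X l m \<phi> \<in> hom (level X m) (level X l)" for l m \<phi>
    using X by (simp add: is_abelian_cubegroup_def)
  interpret g: comm_group "level X m" for m by (rule G)
  have cl: "a \<in> cubes X m \<Longrightarrow> b \<in> cubes X m \<Longrightarrow> cmult X m a b \<in> cubes X m" for a b m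
    using g.m_closed[of a m b] by (simp add: level_def)
  have on: "cone X m \<in> cubes X m" for m using g.one_closed[of m] by (simp add: level_def)
  have rm: "\<phi> \<in> box_hom l m \<Longrightarrow> a \<in> cubes X m \<Longrightarrow> b \<in> cubes X m \<Longrightarrow>
      restr X l m \<phi> (cmult X m a b) = cmult X l (restr X l m \<phi> a) (restr X l m \<phi> b)" for \<phi> l m a b
    using Rh by (auto simp: hom_def level_def)
  have r1: "\<phi> \<in> box_hom l m \<Longrightarrow> restr X l m \<phi> (cone X m) = cone X l" for \<phi> l m
    using hom_one[OF Rh g.group_axioms g.group_axioms] by (simp add: level_def)
  have kr: "\<phi> \<in> box_hom l m \<Longrightarrow> c \<in> K_cubes n m \<Longrightarrow> compose (cube l) c \<phi> \<in> K_cubes n l" for \<phi> l m c n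
    using is_cubeset_K[of n] by (auto simp: is_cubeset_def K_cubeset_def)
  define iv where "iv m a = inv\<^bsub>level X m\<^esub> a" for m a
  have ivc: "a \<in> cubes X m \<Longrightarrow> iv m a \<in> cubes X m \<and> cmult X m (iv m a) a = cone X m" for a m
    using g.inv_closed[of a m] g.l_inv[of a m] by (simp add: level_def iv_def)
  have ivr: "\<phi> \<in> box_hom l m \<Longrightarrow> a \<in> cubes X m \<Longrightarrow> restr X l m \<phi> (iv m a) = iv l (restr X l m \<phi> a)" for \<phi> l m a
    using group_hom.hom_inv[of "level X m" "level X l" "restr X l m \<phi>" a] Rh[of \<phi> l m]
    by (simp add: group_hom_def group_hom_axioms_def iv_def) (simp add: level_def)
  have ass: "a \<in> cubes X m \<Longrightarrow> b \<in> cubes X m \<Longrightarrow> c \<in> cubes X m \<Longrightarrow> cmult X m (cmult X m a b) c = cmult X m a (cmult X m b c)" for a b c m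
    using g.m_assoc[of a m b c] by (simp add: level_def)
  have com: "a \<in> cubes X m \<Longrightarrow> b \<in> cubes X m \<Longrightarrow> cmult X m a b = cmult X m b a" for a b m
    using g.m_comm[of a m b] by (simp add: level_def)
  have lon: "a \<in> cubes X m \<Longrightarrow> cmult X m (cone X m) a = a" for a m
    using g.l_one[of a m] by (simp add: level_def)
  have ron: "a \<in> cubes X m \<Longrightarrow> cmult X m a (cone X m) = a" for a m
    using com[of a m "cone X m"] on lon by simp
  have lcm: "a \<in> cubes X m \<Longrightarrow> b \<in> cubes X m \<Longrightarrow> c \<in> cubes X m \<Longrightarrow>
      cmult X m a (cmult X m b c) = cmult X m b (cmult X m a c)" for a b c m
    using ass[of a m b c] ass[of b m a c] com[of a m b] by simp
  have HomD: "F \<in> cubeset_hom (K_cubeset n) X \<longleftrightarrow> (\<forall>m. F m \<in> K_cubes n m \<rightarrow>\<^sub>E cubes X m) \<and>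
     (\<forall>l m. \<forall>\<phi>\<in>box_hom l m. \<forall>c\<in>K_cubes n m. F l (compose (cube l) c \<phi>) = restr X l m \<phi> (F m c))" for F n
    by (simp add: cubeset_hom_def K_cubeset_def)
  have Fc: "F \<in> cubeset_hom (K_cubeset n) X \<Longrightarrow> c \<in> K_cubes n m \<Longrightarrow> F m c \<in> cubes X m" for F n c m
    by (auto simp: HomD)
  have Fx: "F \<in> cubeset_hom (K_cubeset n) X \<Longrightarrow> c \<notin> K_cubes n m \<Longrightarrow> F m c = undefined" for F n c m
    by (fastforce simp: HomD PiE_iff extensional_def)
  have comm: "comm_group (sgrp (K_star X) n)" for n
  proof (rule comm_groupI)
    fix F assume F: "F \<in> carrier (sgrp (K_star X) n)"
    let ?G = "\<lambda>m. \<lambda>c\<in>K_cubes n m. iv m (F m c)"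
    have "?G \<in> carrier (sgrp (K_star X) n)" using F ivc ivr kr
      by (simp add: K_star_def HomD PiE_iff)
    moreover have "?G \<otimes>\<^bsub>sgrp (K_star X) n\<^esub> F = \<one>\<^bsub>sgrp (K_star X) n\<^esub>"
      using F ivc Fc by (fastforce simp: K_star_def fun_eq_iff)
    ultimately show "\<exists>G\<in>carrier (sgrp (K_star X) n). G \<otimes>\<^bsub>sgrp (K_star X) n\<^esub> F = \<one>\<^bsub>sgrp (K_star X) n\<^esub>" by blast
  next
    fix F G assume "F \<in> carrier (sgrp (K_star X) n)" "G \<in> carrier (sgrp (K_star X) n)"
    then show "F \<otimes>\<^bsub>sgrp (K_star X) n\<^esub> G \<in> carrier (sgrp (K_star X) n)"
      using cl rm kr by (simp add: K_star_def HomD PiE_iff)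
  qed (auto simp: K_star_def HomD on r1 kr fun_eq_iff ass com lcm lon ron PiE_iff cl extensional_def)
  have hm: "sact (K_star X) k n \<sigma> \<in> hom (sgrp (K_star X) n) (sgrp (K_star X) k)" if s: "\<sigma> \<in> delta_hom k n" for k n \<sigma>
  proof (rule homI)
    fix F assume F: "F \<in> carrier (sgrp (K_star X) n)"
    have "(\<lambda>x\<in>cube l. \<sigma> ` (compose (cube l) c \<phi> x)) = compose (cube l) (\<lambda>x\<in>cube m. \<sigma> ` c x) \<phi>"
      if "\<phi> \<in> box_hom l m" for c \<phi> l m using that by (auto simp: compose_def box_hom_def fun_eq_iff)
    then show "sact (K_star X) k n \<sigma> F \<in> carrier (sgrp (K_star X) k)"
      using F K_cubes_image[OF s] kr by (auto simp: K_star_def HomD PiE_iff)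
  qed (use K_cubes_image[OF s] in \<open>auto simp: K_star_def fun_eq_iff\<close>)
  have idd: "sact (K_star X) n n (\<lambda>i\<in>{..n}. i) F = F" if "F \<in> carrier (sgrp (K_star X) n)" for n F
  proof -
    have "(\<lambda>x\<in>cube m. (\<lambda>i\<in>{..n}. i) ` c x) = c" if "c \<in> K_cubes n m" for c m
    proof
      fix x show "(\<lambda>x\<in>cube m. (\<lambda>i\<in>{..n}. i) ` c x) x = c x"
      proof (cases "x \<in> cube m")
        case True then have "c x \<subseteq> {..n}" using K_cubes_Sub[OF that] by (auto simp: Sub_def)
        then have "(\<lambda>i\<in>{..n}. i) ` c x = id ` c x" by (intro image_cong) auto
        then show ?thesis using True by simp
      next
        case False then show ?thesis using that by (auto simp: K_cubes_def)
      qed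
    qed
    then have "F m (\<lambda>x\<in>cube m. (\<lambda>i\<in>{..n}. i) ` c x) = F m c" if "c \<in> K_cubes n m" for c m
      using that by simp
    moreover have "F m c = undefined" if "c \<notin> K_cubes n m" for c m
      using that Fx[of F n c m] \<open>F \<in> carrier _\<close> by (simp add: K_star_def)
    ultimately show ?thesis by (auto simp: K_star_def fun_eq_iff)
  qed
  have cp: "sact (K_star X) k n (compose {..k} \<tau> \<sigma>) F = sact (K_star X) k m \<sigma> (sact (K_star X) m n \<tau> F)"
    if "\<sigma>\<in>delta_hom k m" "\<tau>\<in>delta_hom m n" for k m n \<sigma> \<tau> F
  proof -
    have "(\<lambda>x\<in>cube j. compose {..k} \<tau> \<sigma> ` c x) = (\<lambda>x\<in>cube j. \<tau> ` (\<lambda>x\<in>cube j. \<sigma> ` c x) x)" if "c \<in> K_cubes k j" for c j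
      proof (rule restrict_ext)
      fix x assume x: "x \<in> cube j"
      then have "c x \<subseteq> {..k}" using K_cubes_Sub[OF that] by (auto simp: Sub_def)
      then show "compose {..k} \<tau> \<sigma> ` c x = \<tau> ` (\<lambda>x\<in>cube j. \<sigma> ` c x) x"
        using x by (auto simp: compose_def image_image subset_iff intro!: image_cong)
    qed
    moreover have "(\<lambda>x\<in>cube j. \<sigma> ` c x) \<in> K_cubes m j" if "c \<in> K_cubes k j" for c j
      using K_cubes_image[OF \<open>\<sigma> \<in> delta_hom k m\<close> that] .
    ultimately show ?thesis unfolding K_star_def by (intro ext) (simp del: restrict_apply add: restrict_apply'[of _ "K_cubes _ _"] restrict_def[of _ "K_cubes _ _"])
  qed
  show ?thesis unfolding simplicial_abelian_group_def using comm hm idd cp by blast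
qed

end

theory Submission
  imports Defs
begin

text \<open>Cubes in \<open>\<D>\<^sub>n(A)\<close> are determined by their vertices, so \<open>K\<^sup>*\<D>\<^sub>n(A)\<close> in degree \<open>m\<close> is
  a group of functions on the set \<open>Sub m\<close> of vertices of \<open>K\<^sub>m\<close>. The normalised chains of the
  simplicial group of all functions \<open>Sub m \<rightarrow> A\<close> in degree \<open>p\<close> are spanned by the indicators of
  \<open>{0..p}\<close> and, for \<open>p \<ge> 1\<close>, of \<open>{1..p}\<close>, and the differential sends the latter to the
  indicator of \<open>{0..p-1}\<close>. So this group is the sum over all \<open>k\<close> of the contractible groups
  \<open>E(A, k)\<close> that Dold--Kan assigns to the identity \<open>A \<rightarrow> A\<close> in degrees \<open>k + 1\<close> and \<open>k\<close>.
  The subgroup \<open>K\<^sup>*\<D>\<^sub>n(A)\<close> is its \<open>n\<close>-skeleton. Indeed, the image of a degenerable cube in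
  \<open>Sub p\<close> depends on at most \<open>p\<close> coordinates, whereas for each of the two chains in degree
  \<open>p\<close> there is a degenerable \<open>p\<close>-cube on which it is nonzero at exactly one vertex, hence of
  degree \<open>p\<close>. The \<open>n\<close>-skeleton keeps \<open>E(A, k)\<close> for \<open>k < n\<close> and the part of \<open>E(A, n)\<close> in
  degree \<open>n\<close>, which is \<open>K(A, n)\<close>.\<close>

text \<open>The matrix \<open>w\<close> is unitriangular for the weight \<open>\<mu>\<close>, so
  solving in order of increasing weight needs no division and works over any abelian group. It
  serves both for interpolation by monomials and for decomposing functions on
  \<open>Sub m\<close>.\<close>

lemma triangular_system_solvable:
  fixes f :: "'s \<Rightarrow> 'a::ab_group_add" and \<mu> :: "'s \<Rightarrow> nat"
  assumes fin: "finite X" and refl: "\<And>S. S \<in> X \<Longrightarrow> w S S"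
    and less: "\<And>S T. S \<in> X \<Longrightarrow> T \<in> X \<Longrightarrow> w S T \<Longrightarrow> S \<noteq> T \<Longrightarrow> \<mu> S < \<mu> T"
  shows "\<exists>c. \<forall>T\<in>X. f T = (\<Sum>S\<in>X. if w S T then c S else 0)"
proof -
  have "\<exists>c. \<forall>T\<in>X. \<mu> T < k \<longrightarrow> f T = (\<Sum>S\<in>X. if w S T then c S else 0)" for k
  proof (induction k)
    case (Suc k)
    then obtain c where c: "\<And>T. T \<in> X \<Longrightarrow> \<mu> T < k \<Longrightarrow> f T = (\<Sum>S\<in>X. if w S T then c S else 0)"
      by blast
    define c' where "c' S = (if \<mu> S = k
        then f S - (\<Sum>S'\<in>X - {S}. if w S' S then c S' else 0) else c S)" for S
    \<comment> \<open>Off the diagonal only \<open>S\<close> of weight below \<open>\<mu> T\<close>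
      enter, and there \<open>c'\<close> agrees with \<open>c\<close>.\<close>
    have rest: "(\<Sum>S\<in>X - {T}. if w S T then c' S else 0) = (\<Sum>S\<in>X - {T}. if w S T then c S else 0)"
      if "T \<in> X" "\<mu> T \<le> k" for T
    proof (rule sum.cong)
      fix S assume "S \<in> X - {T}"
      then show "(if w S T then c' S else 0) = (if w S T then c S else 0)"
        using that less[of S T] by (auto simp: c'_def)
    qed simp
    have "f T = (\<Sum>S\<in>X. if w S T then c' S else 0)" if T: "T \<in> X" "\<mu> T < Suc k" for T
    proof (cases "\<mu> T = k")
      case True
      then show ?thesis
        using T rest[of T] by (simp add: sum.remove[OF fin T(1)] refl c'_def)
    next
      case False
      then show ?thesis
        using T rest[of T] c[of T] by (simp add: sum.remove[OF fin T(1)] refl c'_def)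
    qed
    then show ?case by blast
  qed simp
  from this[of "Suc (Max (\<mu> ` X))"] show ?thesis
    using fin by (simp add: less_Suc_eq_le)
qed


section \<open>Polynomial cubes\<close>

text \<open>The bound on the degree is strict, so that \<open>d = 0\<close> leaves only the zero
  function and "degree less than \<open>p\<close>" makes sense for \<open>p = 0\<close> too.\<close>

definition low_degree :: "nat \<Rightarrow> nat \<Rightarrow> ((nat \<Rightarrow> int) \<Rightarrow> 'a::ab_group_add) set" where
  "low_degree d m = {c. \<exists>a :: nat set \<Rightarrow> 'a. c = (\<lambda>x\<in>cube m.
     \<Sum>S | S \<subseteq> {..<m} \<and> card S < d. if (\<Prod>i\<in>S. x i) = 1 then a S else 0)}"

lemma poly_cubes_eq_low_degree: "poly_cubes n m = low_degree (Suc n) m"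
  by (simp add: poly_cubes_def low_degree_def less_Suc_eq_le)

lemma cube_values: "x \<in> cube m \<Longrightarrow> i < m \<Longrightarrow> x i = 0 \<or> x i = 1"
  by (auto simp: cube_def PiE_iff)

lemma cube_prod_eq_1:
  assumes "x \<in> cube m" "S \<subseteq> {..<m}"
  shows "(\<Prod>i\<in>S. x i) = 1 \<longleftrightarrow> (\<forall>i\<in>S. x i = 1)"
proof
  assume p: "(\<Prod>i\<in>S. x i) = 1"
  have "finite S" using assms(2) finite_subset by blast
  then have "x i \<noteq> 0" if "i \<in> S" for i
    using p that prod_zero[of S x] by fastforce
  then show "\<forall>i\<in>S. x i = 1" using cube_values[OF assms(1)] assms(2) by blast
qed simp

definition vertex :: "nat \<Rightarrow> nat set \<Rightarrow> nat \<Rightarrow> int" where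
  "vertex m S = (\<lambda>i\<in>{..<m}. if i \<in> S then 1 else 0)"

lemma vertex_in_cube: "vertex m S \<in> cube m"
  by (auto simp: vertex_def cube_def)

lemma finite_low_monomials: "finite {S. S \<subseteq> {..<m::nat} \<and> P S}"
  by (rule finite_subset[of _ "Pow {..<m}"]) auto

lemma restrict_in_low_degree_iff:
  "(\<lambda>x\<in>cube m. c x) \<in> low_degree d m \<longleftrightarrow>
    (\<exists>a. \<forall>x\<in>cube m. c x = (\<Sum>S | S \<subseteq> {..<m} \<and> card S < d. if (\<Prod>i\<in>S. x i) = 1 then a S else 0))"
proof -
  have "(\<lambda>x\<in>cube m. c x) = (\<lambda>x\<in>cube m. g x) \<longleftrightarrow> (\<forall>x\<in>cube m. c x = g x)" for g
    by (metis restrict_apply' restrict_ext)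
  then show ?thesis unfolding low_degree_def mem_Collect_eq by presburger
qed

lemma low_degree_mono:
  assumes "d \<le> d'" shows "low_degree d m \<subseteq> low_degree d' m"
proof
  fix c :: "(nat \<Rightarrow> int) \<Rightarrow> 'a" assume "c \<in> low_degree d m"
  then obtain a where c: "c = (\<lambda>x\<in>cube m.
     \<Sum>S | S \<subseteq> {..<m} \<and> card S < d. if (\<Prod>i\<in>S. x i) = 1 then a S else 0)"
    by (auto simp: low_degree_def)
  have "c = (\<lambda>x\<in>cube m. \<Sum>S | S \<subseteq> {..<m} \<and> card S < d'.
      if (\<Prod>i\<in>S. x i) = 1 then (if card S < d then a S else 0) else 0)"
    unfolding c using assms
    by (intro restrict_ext sum.mono_neutral_cong_left) (auto simp: finite_low_monomials)
  then show "c \<in> low_degree d' m"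
    unfolding low_degree_def by (intro CollectI exI[of _ "\<lambda>S. if card S < d then a S else 0"])
qed

lemma low_degree_zero: "(\<lambda>x\<in>cube m. 0) \<in> low_degree d m"
  unfolding low_degree_def by (rule CollectI, rule exI[of _ "\<lambda>_. 0"]) (auto intro!: sum.neutral)

lemma low_degree_add:
  assumes "(\<lambda>x\<in>cube m. c x) \<in> low_degree d m" "(\<lambda>x\<in>cube m. c' x) \<in> low_degree d m"
  shows "(\<lambda>x\<in>cube m. c x + c' x) \<in> low_degree d m"
proof -
  from assms obtain a a' where
    "\<And>x. x \<in> cube m \<Longrightarrow> c x = (\<Sum>S | S \<subseteq> {..<m} \<and> card S < d. if (\<Prod>i\<in>S. x i) = 1 then a S else 0)"
    "\<And>x. x \<in> cube m \<Longrightarrow> c' x = (\<Sum>S | S \<subseteq> {..<m} \<and> card S < d. if (\<Prod>i\<in>S. x i) = 1 then a' S else 0)"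
    unfolding restrict_in_low_degree_iff by blast
  then show ?thesis
    unfolding restrict_in_low_degree_iff
    by (intro exI[of _ "\<lambda>S. a S + a' S"]) (auto simp: sum.distrib[symmetric] intro!: sum.cong)
qed

lemma low_degree_uminus:
  assumes "(\<lambda>x\<in>cube m. c x) \<in> low_degree d m"
  shows "(\<lambda>x\<in>cube m. - c x) \<in> low_degree d m"
proof -
  from assms obtain a where
    "\<And>x. x \<in> cube m \<Longrightarrow> c x = (\<Sum>S | S \<subseteq> {..<m} \<and> card S < d. if (\<Prod>i\<in>S. x i) = 1 then a S else 0)"
    unfolding restrict_in_low_degree_iff by blast
  then show ?thesis
    unfolding restrict_in_low_degree_iff
    by (intro exI[of _ "\<lambda>S. - a S"]) (auto simp: sum_negf[symmetric] intro!: sum.cong)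
qed

lemma low_degree_sum:
  assumes "\<And>j. j \<in> J \<Longrightarrow> (\<lambda>x\<in>cube m. c j x) \<in> low_degree d m"
  shows "(\<lambda>x\<in>cube m. \<Sum>j\<in>J. c j x) \<in> low_degree d m"
  using assms
proof (induction J rule: infinite_finite_induct)
  case (insert j J)
  have "(\<lambda>x\<in>cube m. \<Sum>j\<in>J. c j x) \<in> low_degree d m"
    using insert.prems by (intro insert.IH) blast
  from low_degree_add[OF insert.prems[OF insertI1] this] show ?case
    by (simp only: sum.insert[OF insert.hyps])
qed (use low_degree_zero in \<open>simp_all only: sum.empty sum.infinite not_False_eq_True\<close>)

text \<open>The coefficients solve the triangular system given by inclusion of subsets of \<open>I\<close>.\<close>

lemma low_degree_if_few_coordinates:
  assumes I: "I \<subseteq> {..<m}" "card I < d"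
    and dep: "\<And>x y. x \<in> cube m \<Longrightarrow> y \<in> cube m \<Longrightarrow> (\<And>i. i \<in> I \<Longrightarrow> x i = y i) \<Longrightarrow> c x = c y"
  shows "(\<lambda>x\<in>cube m. c x) \<in> low_degree d m"
proof -
  have finI: "finite I" using I(1) finite_subset by blast
  obtain a where a: "\<And>T. T \<in> Pow I \<Longrightarrow> c (vertex m T) = (\<Sum>S\<in>Pow I. if S \<subseteq> T then a S else 0)"
    using triangular_system_solvable[of "Pow I" "(\<subseteq>)" card "\<lambda>T. c (vertex m T)"] finI
    by (auto intro: psubset_card_mono finite_subset)
  have "c x = (\<Sum>S | S \<subseteq> {..<m} \<and> card S < d.
      if (\<Prod>i\<in>S. x i) = 1 then (if S \<subseteq> I then a S else 0) else 0)" if x: "x \<in> cube m" for x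
  proof -
    define T where "T = {i\<in>I. x i = 1}"
    have "c x = c (vertex m T)"
    proof (rule dep[OF x vertex_in_cube])
      fix i assume "i \<in> I"
      then show "x i = vertex m T i"
        using I(1) cube_values[OF x, of i] by (auto simp: vertex_def T_def)
    qed
    also have "\<dots> = (\<Sum>S\<in>Pow I. if S \<subseteq> T then a S else 0)"
      by (rule a) (auto simp: T_def)
    also have "\<dots> = (\<Sum>S | S \<subseteq> {..<m} \<and> card S < d.
      if (\<Prod>i\<in>S. x i) = 1 then (if S \<subseteq> I then a S else 0) else 0)"
    proof (rule sum.mono_neutral_cong_left)
      show "Pow I \<subseteq> {S. S \<subseteq> {..<m} \<and> card S < d}"
        using I finI by (auto dest: card_mono)
      show "(if S \<subseteq> T then a S else 0) =
          (if (\<Prod>i\<in>S. x i) = 1 then if S \<subseteq> I then a S else 0 else 0)" if "S \<in> Pow I" for S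
        using that I cube_prod_eq_1[OF x, of S] by (auto simp: T_def)
    qed (auto simp: finite_low_monomials)
    finally show ?thesis .
  qed
  then show ?thesis unfolding restrict_in_low_degree_iff
    by (intro exI[of _ "\<lambda>S. if S \<subseteq> I then a S else 0"] ballI)
qed

text \<open>The function is \<open>b\<close> times the top monomial. It vanishes at all other
  vertices, which kills the lower coefficients by induction on \<open>card S\<close>; nothing is
  left to produce \<open>b\<close> at the top vertex.\<close>

lemma top_monomial_not_low_degree:
  assumes "(\<lambda>x\<in>cube p. if \<forall>i<p. x i = 1 then b else 0) \<in> low_degree p p"
  shows "b = 0"
proof -
  obtain a where a: "(\<lambda>x\<in>cube p. if \<forall>i<p. x i = 1 then b else 0) =
      (\<lambda>x\<in>cube p. \<Sum>S | S \<subseteq> {..<p} \<and> card S < p. if (\<Prod>i\<in>S. x i) = 1 then a S else 0)"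
    using assms by (auto simp: low_degree_def)
  have ev: "(if {..<p} \<subseteq> T then b else 0) = (\<Sum>S | S \<subseteq> {..<p} \<and> card S < p. if S \<subseteq> T then a S else 0)" for T
  proof -
    have "(if {..<p} \<subseteq> T then b else 0) = (if \<forall>i<p. vertex p T i = 1 then b else 0)"
      by (auto simp: vertex_def)
    also have "\<dots> = (\<Sum>S | S \<subseteq> {..<p} \<and> card S < p. if (\<Prod>i\<in>S. vertex p T i) = 1 then a S else 0)"
      using fun_cong[OF a, of "vertex p T"] by (simp add: vertex_in_cube)
    also have "\<dots> = (\<Sum>S | S \<subseteq> {..<p} \<and> card S < p. if S \<subseteq> T then a S else 0)"
      using cube_prod_eq_1[OF vertex_in_cube] by (intro sum.cong) (auto simp: vertex_def)
    finally show ?thesis .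
  qed
  have low: "a S = 0" if "S \<subseteq> {..<p}" "card S < p" for S
    using that
  proof (induction "card S" arbitrary: S rule: less_induct)
    case less
    then have nt: "\<not> {..<p} \<subseteq> S" by auto
    have fS: "finite S" using less(2) finite_subset by blast
    \<comment> \<open>By induction the coefficients of the proper subsets of \<open>S\<close>
      vanish, so evaluation at the vertex of \<open>S\<close> isolates \<open>a S\<close>.\<close>
    have "(\<Sum>T | T \<subseteq> {..<p} \<and> card T < p. if T \<subseteq> S then a T else 0) = (\<Sum>T\<in>{S}. a T)"
    proof (rule sum.mono_neutral_cong_right)
      show "\<forall>T\<in>{T. T \<subseteq> {..<p} \<and> card T < p} - {S}. (if T \<subseteq> S then a T else 0) = 0"
        using less(1) psubset_card_mono[OF fS] by auto
    qed (use less in \<open>auto simp: finite_low_monomials\<close>)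
    with ev[of S] nt show ?case by simp
  qed
  have "b = (\<Sum>S | S \<subseteq> {..<p} \<and> card S < p. if S \<subseteq> {..<p} then a S else 0)"
    using ev[of "{..<p}"] by simp
  also have "\<dots> = 0" using low by (intro sum.neutral) auto
  finally show ?thesis .
qed


section \<open>Maps between cubes and degenerable cubes\<close>

text \<open>An affine form with values 0 and 1 on the cube cannot have two nonzero coefficients: on
  the face spanned by the two coordinates it would take another value.\<close>

lemma box_hom_coordinate:
  assumes "\<phi> \<in> box_hom m k" "j < k"
  shows "\<exists>I\<subseteq>{..<m}. card I \<le> 1 \<and>
    (\<forall>x\<in>cube m. \<forall>y\<in>cube m. (\<forall>i\<in>I. x i = y i) \<longrightarrow> \<phi> x j = \<phi> y j)"
proof -
  obtain b M where \<phi>: "\<phi> \<in> cube m \<rightarrow>\<^sub>E cube k"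
      "\<And>x. x \<in> cube m \<Longrightarrow> \<phi> x j = b j + (\<Sum>i<m. (M j i :: int) * x i)"
    using assms by (auto simp: box_hom_def)
  have at: "\<phi> (vertex m S) j = b j + (\<Sum>i\<in>S. M j i)" if "S \<subseteq> {..<m}" for S
  proof -
    have "(\<Sum>i<m. M j i * vertex m S i) = (\<Sum>i\<in>S. M j i)"
      using that by (intro sum.mono_neutral_cong_right) (auto simp: vertex_def)
    then show ?thesis using \<phi>(2)[OF vertex_in_cube] by simp
  qed
  have val: "\<phi> (vertex m S) j \<in> {0, 1}" for S
    using \<phi>(1) vertex_in_cube[of m S] assms(2) cube_values[of "\<phi> (vertex m S)" k j] by auto
  define I where "I = {i. i < m \<and> M j i \<noteq> 0}"
  have "i = i'" if "i \<in> I" "i' \<in> I" for i i'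
  proof (rule ccontr)
    assume "i \<noteq> i'"
    have "b j \<in> {0, 1}" "b j + M j i \<in> {0, 1}" "b j + M j i' \<in> {0, 1}"
      "b j + (M j i + M j i') \<in> {0, 1}"
      using val[of "{}"] val[of "{i}"] val[of "{i'}"] val[of "{i, i'}"] that \<open>i \<noteq> i'\<close>
        at[of "{}"] at[of "{i}"] at[of "{i'}"] at[of "{i, i'}"]
      by (simp_all add: I_def)
    then show False using that by (simp only: insert_iff empty_iff I_def mem_Collect_eq) presburger
  qed
  then have "card I \<le> 1" by (simp add: I_def card_le_Suc0_iff_eq)
  moreover have "\<phi> x j = \<phi> y j" if "x \<in> cube m" "y \<in> cube m" "\<forall>i\<in>I. x i = y i" for x y
  proof -
    have "(\<Sum>i<m. M j i * x i) = (\<Sum>i<m. M j i * y i)"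
      using that(3) by (intro sum.cong) (auto simp: I_def)
    then show ?thesis using that \<phi>(2) by simp
  qed
  moreover have "I \<subseteq> {..<m}" by (auto simp: I_def)
  ultimately show ?thesis by blast
qed

text \<open>A map that identifies \<open>r\<close> and \<open>Suc r\<close> factors through
  \<open>degen r\<close>: it is \<open>degen r\<close>, followed by the injection skipping
  \<open>Suc r\<close>, followed by the map itself.\<close>

lemma image_cong_degen:
  assumes "\<tau> r = \<tau> (Suc r)" "degen r ` X = degen r ` Y"
  shows "\<tau> ` X = \<tau> ` Y"
proof -
  have "\<tau> j = \<tau> (if degen r j \<le> r then degen r j else Suc (degen r j))" for j
    using assms(1) le_Suc_eq[of j r] by (auto simp: degen_def not_le Suc_diff_Suc)
  then have "\<tau> ` Z = (\<lambda>i. \<tau> (if i \<le> r then i else Suc i)) ` degen r ` Z" for Z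
    unfolding image_image by (intro image_cong) auto
  then show ?thesis using assms(2) by simp
qed

text \<open>Pass from \<open>x\<close> to \<open>y\<close> one coordinate at a time. Changing
  coordinate \<open>r\<close> does not affect the image under \<open>degen r\<close>, through which
  \<open>\<tau>\<close> factors unless it jumps after \<open>r\<close>; at a jump \<open>x\<close>
  and \<open>y\<close> agree already.\<close>

lemma degenerable_image_depends_on_jumps:
  assumes B: "B \<in> degenerable k" and x: "x \<in> cube k" and y: "y \<in> cube k"
    and eq: "\<And>j. j < k \<Longrightarrow> \<tau> j \<noteq> \<tau> (Suc j) \<Longrightarrow> x j = y j"
  shows "\<tau> ` B x = \<tau> ` B y"
proof -
  define z where "z r = (\<lambda>j. if j < r then y j else x j)" for r
  have z: "z r \<in> cube k" for r
    using x y by (auto simp: z_def cube_def PiE_iff extensional_def)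
  have "\<tau> ` B x = \<tau> ` B (z r)" if "r \<le> k" for r
    using that
  proof (induction r)
    case 0
    then show ?case by (simp add: z_def)
  next
    case (Suc r)
    have "\<tau> ` B (z r) = \<tau> ` B (z (Suc r))"
    proof (cases "\<tau> r = \<tau> (Suc r)")
      case True
      have "degen r ` B (z r) = degen r ` B (z (Suc r))"
        using B z Suc.prems by (auto simp: degenerable_def z_def)
      with True show ?thesis by (rule image_cong_degen)
    next
      case False
      then have "z r = z (Suc r)"
        using eq[of r] Suc.prems by (auto simp: z_def fun_eq_iff less_Suc_eq)
      then show ?thesis by simp
    qed
    then show ?case using Suc by simp
  qed
  moreover have "z k = y"
  proof
    fix j show "z k j = y j"
      using x y by (cases "j < k") (auto simp: z_def cube_def PiE_iff extensional_def)
  qed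
  ultimately show ?thesis by (metis order_refl)
qed

text \<open>The values just after the jumps are distinct and positive, so they embed into
  \<open>{1..p}\<close>.\<close>

lemma card_jumps_le:
  assumes "\<tau> \<in> {..k} \<rightarrow> {..p}" "mono_on {..k} \<tau>"
  shows "card {j. j < k \<and> \<tau> j \<noteq> \<tau> (Suc j)} \<le> (p::nat)"
proof -
  define J where "J = {j. j < k \<and> \<tau> j \<noteq> \<tau> (Suc j)}"
  have step: "\<tau> j < \<tau> (Suc j)" if "j \<in> J" for j
    using that monotone_onD[OF assms(2), of j "Suc j"] by (simp add: J_def Suc_leI)
  have lt: "\<tau> (Suc i) < \<tau> (Suc j)" if "i \<in> J" "j \<in> J" "i < j" for i j
    using that step[of j] monotone_onD[OF assms(2), of "Suc i" j] by (auto simp: J_def)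
  have "inj_on (\<lambda>j. \<tau> (Suc j)) J"
    by (rule linorder_inj_onI') (use lt in force)
  moreover have "(\<lambda>j. \<tau> (Suc j)) ` J \<subseteq> {1..p}"
    using step assms(1) by (fastforce simp: J_def Suc_le_eq)
  ultimately have "card J \<le> card {1..p}"
    using card_inj_on_le by blast
  then show ?thesis by (simp add: J_def)
qed

text \<open>This is the upper bound on degrees. Pushed to \<open>Sub p\<close>, the labels depend
  only on the coordinates of the degenerable cube at which \<open>\<tau>\<close> jumps. There are at
  most \<open>p\<close> of them, and each is governed by at most one coordinate of the
  \<open>l\<close>-cube.\<close>

lemma K_cube_low_degree:
  assumes \<eta>: "\<eta> \<in> delta_hom m p" and c: "c \<in> K_cubes m l"
  shows "(\<lambda>x\<in>cube l. g (\<eta> ` c x)) \<in> low_degree (Suc p) l"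
proof -
  obtain k \<phi> B \<sigma> where \<phi>: "\<phi> \<in> box_hom l k" and B: "B \<in> degenerable k"
    and \<sigma>: "\<sigma> \<in> delta_hom k m" and c_eq: "c = (\<lambda>x\<in>cube l. \<sigma> ` B (\<phi> x))"
    using c by (auto simp: K_cubes_def)
  define \<tau> where "\<tau> = (\<lambda>i. \<eta> (\<sigma> i))"
  define J where "J = {j. j < k \<and> \<tau> j \<noteq> \<tau> (Suc j)}"
  have "\<tau> \<in> {..k} \<rightarrow> {..p}" "mono_on {..k} \<tau>"
    using \<eta> \<sigma> by (auto simp: \<tau>_def delta_hom_def PiE_iff monotone_on_def)
  then have cardJ: "card J \<le> p" unfolding J_def by (rule card_jumps_le)
  have finJ: "finite J" by (simp add: J_def)
  have "\<forall>j\<in>J. \<exists>I\<subseteq>{..<l}. card I \<le> 1 \<and>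
    (\<forall>x\<in>cube l. \<forall>y\<in>cube l. (\<forall>i\<in>I. x i = y i) \<longrightarrow> \<phi> x j = \<phi> y j)"
    by (intro ballI box_hom_coordinate[OF \<phi>]) (simp add: J_def)
  then obtain V where "\<forall>j\<in>J. V j \<subseteq> {..<l} \<and> card (V j) \<le> 1 \<and>
    (\<forall>x\<in>cube l. \<forall>y\<in>cube l. (\<forall>i\<in>V j. x i = y i) \<longrightarrow> \<phi> x j = \<phi> y j)"
    by (rule bchoice[THEN exE])
  then have V: "\<And>j. j \<in> J \<Longrightarrow> V j \<subseteq> {..<l}" "\<And>j. j \<in> J \<Longrightarrow> card (V j) \<le> 1"
    "\<And>j x y. j \<in> J \<Longrightarrow> x \<in> cube l \<Longrightarrow> y \<in> cube l \<Longrightarrow> (\<forall>i\<in>V j. x i = y i) \<Longrightarrow> \<phi> x j = \<phi> y j"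
    by blast+
  have "card (\<Union>j\<in>J. V j) \<le> (\<Sum>j\<in>J. card (V j))" by (rule card_UN_le[OF finJ])
  also have "\<dots> \<le> card J" using sum_mono[of J "\<lambda>j. card (V j)" "\<lambda>_. 1"] V(2) by simp
  finally have cardV: "card (\<Union>j\<in>J. V j) < Suc p" using cardJ by simp
  show ?thesis
  proof (rule low_degree_if_few_coordinates[OF _ cardV])
    fix x y assume xy: "x \<in> cube l" "y \<in> cube l" "\<And>i. i \<in> (\<Union>j\<in>J. V j) \<Longrightarrow> x i = y i"
    have "\<tau> ` B (\<phi> x) = \<tau> ` B (\<phi> y)"
    proof (rule degenerable_image_depends_on_jumps[OF B])
      show "\<phi> x \<in> cube k" "\<phi> y \<in> cube k"
        using \<phi> xy(1,2) by (auto simp: box_hom_def)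
      fix j assume "j < k" "\<tau> j \<noteq> \<tau> (Suc j)"
      then have j: "j \<in> J" by (simp add: J_def)
      show "\<phi> x j = \<phi> y j"
        by (rule V(3)[OF j xy(1,2)]) (use xy(3) j in blast)
    qed
    then show "g (\<eta> ` c x) = g (\<eta> ` c y)"
      using xy by (simp add: c_eq image_image \<tau>_def)
  qed (use V in auto)
qed

text \<open>Contains \<open>{1..p}\<close> only at the vertex \<open>(1, \<dots>, 1)\<close>; its value there is \<open>{..p}\<close> or
  \<open>{1..p}\<close>, depending on \<open>z\<close>. Degenerability holds because at any vertex one of \<open>j\<close> and
  \<open>j + 1\<close> is present.\<close>

definition corner_cube :: "bool \<Rightarrow> nat \<Rightarrow> (nat \<Rightarrow> int) \<Rightarrow> nat set" where
  "corner_cube z p = (\<lambda>x\<in>cube p.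
     {j. j \<le> p \<and> (j = 0 \<and> z \<or> 0 < j \<and> x (j - 1) = 1 \<or> j < p \<and> x j = 0)})"

text \<open>The hypothesis excludes only \<open>p = 0\<close> with \<open>z\<close> false, where the
  single label would be empty and so not in \<open>Sub 0\<close>.\<close>

lemma corner_cube_degenerable:
  assumes "z \<or> 0 < p" shows "corner_cube z p \<in> degenerable p"
proof -
  have mem: "corner_cube z p x \<in> Sub p" if x: "x \<in> cube p" for x
  proof (cases z)
    case True
    then have "0 \<in> corner_cube z p x" using x by (simp add: corner_cube_def)
    then show ?thesis using x by (auto simp: Sub_def corner_cube_def)
  next
    case False
    then have "x 0 = 0 \<or> x 0 = 1" using assms cube_values[OF x] by blast
    then have "0 \<in> corner_cube z p x \<or> 1 \<in> corner_cube z p x"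
      using x False assms by (auto simp: corner_cube_def)
    then show ?thesis using x by (auto simp: Sub_def corner_cube_def)
  qed
  have sub: "degen i ` corner_cube z p x \<subseteq> degen i ` corner_cube z p y"
    if "i < p" "x \<in> cube p" "y \<in> cube p" "\<forall>j<p. j \<noteq> i \<longrightarrow> x j = y j" for i x y
  proof
    fix d assume "d \<in> degen i ` corner_cube z p x"
    then obtain j where j: "j \<in> corner_cube z p x" "d = degen i j" by blast
    \<comment> \<open>Membership of \<open>j\<close> depends on the coordinates \<open>j - 1\<close>
      and \<open>j\<close> only, so changing coordinate \<open>i\<close> affects just
      \<open>i\<close> and \<open>Suc i\<close>, which \<open>degen i\<close> merges.\<close>
    show "d \<in> degen i ` corner_cube z p y"
    proof (cases "j = i \<or> j = Suc i")
      case True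
      then have "d = i" using j by (auto simp: degen_def)
      have "i \<in> corner_cube z p y \<or> Suc i \<in> corner_cube z p y"
        using that cube_values[OF that(3,1)] by (auto simp: corner_cube_def)
      moreover have "degen i i = i" "degen i (Suc i) = i" by (simp_all add: degen_def)
      ultimately show ?thesis using \<open>d = i\<close> by (metis imageI)
    next
      case False
      have "j \<in> corner_cube z p y"
      proof -
        have "0 < j \<Longrightarrow> j \<le> p \<Longrightarrow> x (j - 1) = y (j - 1)" "j < p \<Longrightarrow> x j = y j"
          using that(4) False by auto
        then show ?thesis using j(1) that(2,3) by (auto simp: corner_cube_def)
      qed
      then show ?thesis using j by blast
    qed
  qed
  have eq: "degen i ` corner_cube z p x = degen i ` corner_cube z p y"
    if "i < p" "x \<in> cube p" "y \<in> cube p" "\<forall>j<p. j \<noteq> i \<longrightarrow> x j = y j" for i x y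
  proof (rule equalityI)
    have "\<forall>j<p. j \<noteq> i \<longrightarrow> y j = x j"
      by (intro allI impI) (rule that(4)[rule_format, symmetric])
    then show "degen i ` corner_cube z p y \<subseteq> degen i ` corner_cube z p x"
      by (rule sub[OF that(1,3,2)])
  qed (rule sub[OF that])
  have "corner_cube z p \<in> cube p \<rightarrow>\<^sub>E Sub p"
    using mem by (intro PiE_I) (simp_all add: corner_cube_def)
  then show ?thesis
    unfolding degenerable_def
  proof (intro CollectI conjI allI ballI impI)
    fix i x y assume "i < p" "x \<in> cube p" "y \<in> cube p" "\<forall>j<p. j \<noteq> i \<longrightarrow> x j = y j"
    then show "degen i ` corner_cube z p x = degen i ` corner_cube z p y" by (rule eq)
  qed
qed

text \<open>Downward induction from the last coordinate: once coordinate \<open>Suc i\<close> is 1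
  or does not exist, the label \<open>Suc i\<close> can only be present through coordinate
  \<open>i\<close>.\<close>

lemma corner_cube_full_iff:
  assumes x: "x \<in> cube p"
  shows "{1..p} \<subseteq> corner_cube z p x \<longleftrightarrow> (\<forall>i<p. x i = 1)"
proof
  assume full: "{1..p} \<subseteq> corner_cube z p x"
  \<comment> \<open>The guard \<open>i < p\<close> makes the induction start vacuously at
    \<open>i = p\<close>.\<close>
  have "i < p \<longrightarrow> x i = 1" if "i \<le> p" for i
    using that
  proof (induction rule: inc_induct)
    case (step i)
    then have "Suc i \<in> corner_cube z p x" using full by auto
    then show ?case using step x by (auto simp: corner_cube_def)
  qed simp
  then show "\<forall>i<p. x i = 1" by simp
next
  assume "\<forall>i<p. x i = 1"
  then show "{1..p} \<subseteq> corner_cube z p x" using x by (auto simp: corner_cube_def)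
qed

lemma zero_in_corner_cube:
  assumes "x \<in> cube p" "{1..p} \<subseteq> corner_cube z p x" "z \<or> 0 < p"
  shows "0 \<in> corner_cube z p x \<longleftrightarrow> z"
  using assms corner_cube_full_iff[OF assms(1), of z] by (auto simp: corner_cube_def)

lemma corner_cube_bounded: "x \<in> cube p \<Longrightarrow> corner_cube z p x \<subseteq> {..p}"
  by (auto simp: corner_cube_def)

lemma restrict_id_box_hom: "(\<lambda>x\<in>cube p. x) \<in> box_hom p p"
proof -
  have "x j = 0 + (\<Sum>i<p. (if i = j then 1 else 0) * x i)" if "j < p" for x :: "nat \<Rightarrow> int" and j
    using that by (simp add: if_distrib[of "\<lambda>c. c * _"] cong: if_cong)
  then show ?thesis unfolding box_hom_def
    by (intro CollectI conjI exI[of _ "\<lambda>_. 0"] exI[of _ "\<lambda>j i. if i = j then 1 else 0"]) auto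
qed

lemma image_degenerable_in_K_cubes:
  assumes "B \<in> degenerable p" "\<sigma> \<in> delta_hom p m"
  shows "(\<lambda>x\<in>cube p. \<sigma> ` B x) \<in> K_cubes m p"
proof -
  have "(\<lambda>x\<in>cube p. \<sigma> ` B x) = (\<lambda>x\<in>cube p. \<sigma> ` B ((\<lambda>x\<in>cube p. x) x))"
    by (rule restrict_ext) simp
  then show ?thesis using assms restrict_id_box_hom unfolding K_cubes_def by blast
qed


section \<open>Epi-mono factorisation\<close>

lemma delta_surjD:
  assumes "(p, \<eta>) \<in> delta_surj m"
  shows "\<eta> \<in> delta_hom m p" "\<eta> ` {..m} = {..p}" "mono_on {..m} \<eta>" "\<eta> \<in> {..m} \<rightarrow>\<^sub>E {..p}"
  using assms by (auto simp: delta_surj_def delta_hom_def)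

lemma delta_surj_degree_le: "(p, \<eta>) \<in> delta_surj m \<Longrightarrow> p \<le> m"
  using card_image_le[of "{..m}" \<eta>] delta_surjD(2)[of p \<eta> m] by simp

lemma finite_delta_surj: "finite (delta_surj m)"
proof (rule finite_subset)
  show "delta_surj m \<subseteq> Sigma {..m} (\<lambda>p. {..m} \<rightarrow>\<^sub>E {..p})"
  proof
    fix z assume "z \<in> delta_surj m"
    then show "z \<in> Sigma {..m} (\<lambda>p. {..m} \<rightarrow>\<^sub>E {..p})"
      using delta_surj_degree_le[of "fst z" "snd z" m] delta_surjD(4)[of "fst z" "snd z" m]
      by (cases z) simp
  qed
qed (auto intro: finite_PiE)

lemma delta_homD:
  assumes "\<alpha> \<in> delta_hom l m"
  shows "mono_on {..l} \<alpha>" "\<alpha> \<in> {..l} \<rightarrow>\<^sub>E {..m}"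
  using assms by (auto simp: delta_hom_def)

lemma delta_hom_compose:
  "\<alpha> \<in> delta_hom l m \<Longrightarrow> \<eta> \<in> delta_hom m p \<Longrightarrow> compose {..l} \<eta> \<alpha> \<in> delta_hom l p"
  by (auto simp: delta_hom_def compose_def monotone_on_def PiE_iff)

lemma finite_delta_hom: "finite (delta_hom l m)"
  by (rule finite_subset[of _ "{..l} \<rightarrow>\<^sub>E {..m}"]) (auto simp: delta_hom_def intro: finite_PiE)

lemma delta_inj_less:
  assumes "\<mu> \<in> delta_hom q p" "inj_on \<mu> {..q}" "i < j" "j \<le> q"
  shows "\<mu> i < \<mu> j"
  using monotone_onD[OF delta_homD(1)[OF assms(1)], of i j] inj_on_eq_iff[OF assms(2), of i j] assms(3,4)
  by (simp add: le_less)

lemma delta_inj_degree_le: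
  assumes "\<mu> \<in> delta_hom q p" "inj_on \<mu> {..q}" shows "q \<le> p"
proof -
  have "\<mu> ` {..q} \<subseteq> {..p}" using delta_homD(2)[OF assms(1)] by auto
  from card_inj_on_le[OF assms(2) this] show ?thesis by simp
qed

text \<open>An argument is recovered as the rank of its value in the image, so a monotone injection
  is determined by its image.\<close>

lemma delta_inj_rank:
  assumes "\<mu> \<in> delta_hom q p" "inj_on \<mu> {..q}" "j \<le> q"
  shows "card {w \<in> \<mu> ` {..q}. w < \<mu> j} = j"
proof -
  have "{w \<in> \<mu> ` {..q}. w < \<mu> j} = \<mu> ` {..<j}"
  proof (intro Set.set_eqI iffI)
    fix w assume "w \<in> {w \<in> \<mu> ` {..q}. w < \<mu> j}"
    then obtain i where i: "i \<le> q" "w = \<mu> i" "\<mu> i < \<mu> j" by auto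
    then have "i < j"
      using monotone_onD[OF delta_homD(1)[OF assms(1)], of j i] assms(3) by (meson atMost_iff not_le)
    then show "w \<in> \<mu> ` {..<j}" using i by blast
  next
    fix w assume "w \<in> \<mu> ` {..<j}"
    then show "w \<in> {w \<in> \<mu> ` {..q}. w < \<mu> j}"
      using delta_inj_less[OF assms(1,2) _ assms(3)] assms(3) by fastforce
  qed
  moreover have "inj_on \<mu> {..<j}" by (rule inj_on_subset[OF assms(2)]) (use assms(3) in auto)
  ultimately show ?thesis by (simp add: card_image)
qed

lemma delta_inj_endo:
  assumes "\<mu> \<in> delta_hom q q" "inj_on \<mu> {..q}" "j \<le> q" shows "\<mu> j = j"
proof -
  have "\<mu> ` {..q} = {..q}"
    using assms(2) delta_homD(2)[OF assms(1)] by (intro card_subset_eq) (auto simp: card_image)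
  moreover have "\<mu> j \<le> q" using assms(3) delta_homD(2)[OF assms(1)] by auto
  ultimately have "{w \<in> \<mu> ` {..q}. w < \<mu> j} = {..<\<mu> j}" by auto
  then show ?thesis using delta_inj_rank[OF assms] by simp
qed

text \<open>Both injections have the image of the composite as their image. This gives
  \<open>q = q'\<close>, and \<open>\<theta> t\<close> is the rank of the common value in that
  image.\<close>

lemma factorisation_unique:
  assumes "(q, \<theta>) \<in> delta_surj l" "\<mu> \<in> delta_hom q p" "inj_on \<mu> {..q}"
    and "(q', \<theta>') \<in> delta_surj l" "\<mu>' \<in> delta_hom q' p" "inj_on \<mu>' {..q'}"
    and eq: "compose {..l} \<mu> \<theta> = compose {..l} \<mu>' \<theta>'"
  shows "q = q' \<and> \<theta> = \<theta>' \<and> \<mu> = \<mu>'"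
proof -
  have eq: "\<mu> (\<theta> t) = \<mu>' (\<theta>' t)" if "t \<le> l" for t
    using fun_cong[OF eq, of t] that by (simp add: compose_def)
  have im: "\<mu> ` {..q} = \<mu>' ` {..q'}"
    using eq unfolding delta_surjD(2)[OF assms(1), symmetric] delta_surjD(2)[OF assms(4), symmetric]
    by (force simp: image_image)
  then have "card {..q} = card {..q'}"
    using assms(3,6) by (metis card_image)
  then have q: "q = q'" by simp
  have \<theta>: "\<theta> t = \<theta>' t" if t: "t \<le> l" for t
  proof -
    have "\<theta> t \<le> q" "\<theta>' t \<le> q'"
      using t delta_surjD(2)[OF assms(1)] delta_surjD(2)[OF assms(4)] by blast+
    then show ?thesis
      using delta_inj_rank[OF assms(2,3), of "\<theta> t"] delta_inj_rank[OF assms(5,6), of "\<theta>' t"] im eq[OF t]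
      by simp
  qed
  then have "\<theta> = \<theta>'"
    using PiE_ext[OF delta_surjD(4)[OF assms(1)] delta_surjD(4)[OF assms(4)[folded q]]] by simp
  moreover have "\<mu> = \<mu>'"
  proof (rule PiE_ext[OF delta_homD(2)[OF assms(2)] delta_homD(2)[OF assms(5)[folded q]]])
    fix j assume "j \<in> {..q}"
    then obtain t where "t \<le> l" "\<theta> t = j" using delta_surjD(2)[OF assms(1)] by (metis atMost_iff imageE)
    then show "\<mu> j = \<mu>' j" using eq[of t] \<theta>[of t] by simp
  qed
  ultimately show ?thesis using q by simp
qed

text \<open>Numbering the image \<open>W\<close> of \<open>g\<close> in increasing order gives the
  surjection, and listing \<open>W\<close> gives the injection.\<close>

lemma factorisation_exists:
  assumes g: "g \<in> delta_hom l p"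
  shows "\<exists>q \<theta> \<mu>. (q, \<theta>) \<in> delta_surj l \<and> \<mu> \<in> delta_hom q p \<and> inj_on \<mu> {..q} \<and> g = compose {..l} \<mu> \<theta>"
proof -
  define W where "W = g ` {..l}"
  define r where "r w = card {v \<in> W. v < w}" for w
  define q where "q = card W - 1"
  have W: "finite W" "W \<noteq> {}" "W \<subseteq> {..p}" using delta_homD(2)[OF g] by (auto simp: W_def)
  then have cW: "card W = Suc q" by (simp add: q_def card_gt_0_iff)
  have r_less: "r v < r w" if "v \<in> W" "v < w" for v w
    unfolding r_def using that W(1) by (intro psubset_card_mono) auto
  then have inj: "inj_on r W" by (intro linorder_inj_onI') force
  have r_iff: "r v \<le> r w \<longleftrightarrow> v \<le> w" if "v \<in> W" "w \<in> W" for v w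
    using r_less that by (metis le_less linorder_not_less)
  have "r w < card W" if "w \<in> W" for w
    unfolding r_def using that W(1) by (intro psubset_card_mono) auto
  then have "r ` W = {..q}"
    using inj cW by (intro card_subset_eq) (auto simp: card_image less_Suc_eq_le)
  then have bij: "bij_betw r W {..q}" using inj by (simp add: bij_betw_def)
  define \<theta> where "\<theta> = (\<lambda>t\<in>{..l}. r (g t))"
  define \<mu> where "\<mu> = (\<lambda>j\<in>{..q}. inv_into W r j)"
  have \<mu>r: "\<mu> (r w) = w" if "w \<in> W" for w
    using that bij bij_betw_apply[OF bij that] by (simp add: \<mu>_def bij_betw_inv_into_left)
  have \<mu>: "\<mu> j \<in> W" "r (\<mu> j) = j" if "j \<le> q" for j
    using that bij bij_betw_inv_into_right[OF bij] bij_betw_apply[OF bij_betw_inv_into[OF bij]]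
    by (auto simp: \<mu>_def)
  have "\<theta> ` {..l} = {..q}"
    using \<open>r ` W = {..q}\<close> by (simp add: \<theta>_def W_def image_image)
  moreover have "mono_on {..l} \<theta>"
    using delta_homD(1)[OF g] by (auto simp: monotone_on_def \<theta>_def r_iff W_def)
  ultimately have "(q, \<theta>) \<in> delta_surj l"
    by (auto simp: delta_surj_def delta_hom_def \<theta>_def)
  moreover have "\<mu> i \<le> \<mu> j" if "i \<le> j" "j \<le> q" for i j
    using that \<mu> r_iff[of "\<mu> i" "\<mu> j"] by simp
  then have "\<mu> \<in> delta_hom q p"
    using \<mu>(1) W(3) by (auto simp: delta_hom_def monotone_on_def PiE_iff) (simp add: \<mu>_def)
  moreover have "inj_on \<mu> {..q}"
    using \<mu>(2) by (intro inj_on_inverseI[of _ r]) auto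
  moreover have "g = compose {..l} \<mu> \<theta>"
    using \<mu>r delta_homD(2)[OF g]
    by (intro PiE_ext[of g "{..l}" "\<lambda>_. {..p}" "compose {..l} \<mu> \<theta>"])
       (auto simp: compose_def \<theta>_def W_def)
  ultimately show ?thesis by blast
qed

section \<open>The index sets of the simplicial action of \<open>dold_kan\<close>\<close>

definition factorisations ::
    "nat \<Rightarrow> nat \<Rightarrow> (nat \<Rightarrow> nat) \<Rightarrow> nat \<times> (nat \<Rightarrow> nat) \<Rightarrow> (nat \<times> (nat \<Rightarrow> nat) \<times> (nat \<Rightarrow> nat)) set" where
  "factorisations l m \<alpha> = (\<lambda>(q, \<theta>). {(p, \<eta>, \<mu>). (p, \<eta>) \<in> delta_surj m \<and> \<mu> \<in> delta_hom q p \<and>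
     inj_on \<mu> {..q} \<and> compose {..l} \<eta> \<alpha> = compose {..l} \<mu> \<theta>})"

lemma finite_factorisations: "finite (factorisations l m \<alpha> z)"
proof (cases z)
  case (Pair q \<theta>)
  have "factorisations l m \<alpha> z \<subseteq> (\<lambda>((p, \<eta>), \<mu>). (p, \<eta>, \<mu>)) `
      Sigma (delta_surj m) (\<lambda>(p, \<eta>). delta_hom q p)"
  proof
    fix w assume w: "w \<in> factorisations l m \<alpha> z"
    obtain p \<eta> \<mu> where "w = (p, \<eta>, \<mu>)" by (metis prod.exhaust)
    with w show "w \<in> (\<lambda>((p, \<eta>), \<mu>). (p, \<eta>, \<mu>)) ` Sigma (delta_surj m) (\<lambda>(p, \<eta>). delta_hom q p)"
      by (intro image_eqI[of _ _ "((p, \<eta>), \<mu>)"]) (simp_all add: factorisations_def Pair)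
  qed
  then show ?thesis
    by (rule finite_subset) (auto intro!: finite_imageI finite_SigmaI finite_delta_surj finite_delta_hom)
qed

text \<open>For each surjection \<open>\<eta>\<close> the composite with \<open>\<alpha>\<close> has
  exactly one epi-mono factorisation, so \<open>(p, \<eta>)\<close> occurs for exactly one
  \<open>(q, \<theta>)\<close> and with exactly one \<open>\<mu>\<close>.\<close>

lemma sum_factorisations:
  fixes F :: "nat \<times> (nat \<Rightarrow> nat) \<Rightarrow> nat \<times> (nat \<Rightarrow> nat) \<times> (nat \<Rightarrow> nat) \<Rightarrow> 'a::comm_monoid_add"
  assumes \<alpha>: "\<alpha> \<in> delta_hom l m"
    and F: "\<And>q \<theta> p \<eta> \<mu>. (q, \<theta>) \<in> delta_surj l \<Longrightarrow> (p, \<eta>, \<mu>) \<in> factorisations l m \<alpha> (q, \<theta>) \<Longrightarrow>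
      F (q, \<theta>) (p, \<eta>, \<mu>) = G (p, \<eta>)"
  shows "(\<Sum>z\<in>delta_surj l. \<Sum>w\<in>factorisations l m \<alpha> z. F z w) = (\<Sum>z\<in>delta_surj m. G z)"
proof -
  let ?h = "\<lambda>(z :: nat \<times> (nat \<Rightarrow> nat), p :: nat, \<eta> :: nat \<Rightarrow> nat, \<mu> :: nat \<Rightarrow> nat). (p, \<eta>)"
  have "bij_betw ?h (Sigma (delta_surj l) (factorisations l m \<alpha>)) (delta_surj m)"
  proof (rule bij_betw_imageI)
    show "inj_on ?h (Sigma (delta_surj l) (factorisations l m \<alpha>))"
    proof (rule inj_onI)
      fix u u' assume u: "u \<in> Sigma (delta_surj l) (factorisations l m \<alpha>)"
        "u' \<in> Sigma (delta_surj l) (factorisations l m \<alpha>)" "?h u = ?h u'"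
      obtain q \<theta> p \<eta> \<mu> where [simp]: "u = ((q, \<theta>), p, \<eta>, \<mu>)" by (metis prod.exhaust)
      obtain q' \<theta>' p' \<eta>' \<mu>' where [simp]: "u' = ((q', \<theta>'), p', \<eta>', \<mu>')" by (metis prod.exhaust)
      have [simp]: "p' = p" "\<eta>' = \<eta>" using u(3) by simp_all
      have "q = q' \<and> \<theta> = \<theta>' \<and> \<mu> = \<mu>'"
        by (rule factorisation_unique[of _ _ l _ p]) (use u in \<open>simp_all add: factorisations_def\<close>)
      then show "u = u'" by simp
    qed
    show "?h ` Sigma (delta_surj l) (factorisations l m \<alpha>) = delta_surj m"
    proof (intro Set.set_eqI iffI)
      fix w assume w: "w \<in> delta_surj m"
      obtain p \<eta> where [simp]: "w = (p, \<eta>)" by force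
      obtain q \<theta> \<mu> where "(q, \<theta>) \<in> delta_surj l" "\<mu> \<in> delta_hom q p" "inj_on \<mu> {..q}"
          "compose {..l} \<eta> \<alpha> = compose {..l} \<mu> \<theta>"
        using factorisation_exists[OF delta_hom_compose[OF \<alpha> delta_surjD(1)]] w by force
      then have "((q, \<theta>), p, \<eta>, \<mu>) \<in> Sigma (delta_surj l) (factorisations l m \<alpha>)"
        using w by (simp add: factorisations_def)
      from imageI[OF this, of ?h]
      show "w \<in> ?h ` Sigma (delta_surj l) (factorisations l m \<alpha>)" by simp
    qed (auto simp: factorisations_def)
  qed
  then have "(\<Sum>z\<in>delta_surj m. G z) =
      (\<Sum>u\<in>Sigma (delta_surj l) (factorisations l m \<alpha>). G (?h u))"
    by (rule sum.reindex_bij_betw[symmetric])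
  also have "\<dots> = (\<Sum>(z, w)\<in>Sigma (delta_surj l) (factorisations l m \<alpha>). F z w)"
    by (rule sum.cong) (auto simp: F)
  also have "\<dots> = (\<Sum>z\<in>delta_surj l. \<Sum>w\<in>factorisations l m \<alpha> z. F z w)"
    by (rule sum.Sigma[symmetric]) (auto simp: finite_delta_surj finite_factorisations)
  finally show ?thesis by simp
qed


section \<open>Dold--Kan images of complexes with identity differentials\<close>

text \<open>One format for both kinds of complexes in the decomposition, so that Dold-Kan
  computations are done once: \<open>concentrated n\<close> has empty \<open>D\<close>, while
  \<open>elementary\<close> uses the identity from degree \<open>Suc k\<close> to
  \<open>k\<close>.\<close>

definition identity_complex :: "nat set \<Rightarrow> nat set \<Rightarrow> 'a::ab_group_add chain_complex" where
  "identity_complex P D = \<lparr>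
     cgrp = (\<lambda>p. if p \<in> P then additive_group else singleton_group 0),
     bd = (\<lambda>p a. if p \<in> D then a else 0)\<rparr>"

lemma concentrated_eq: "concentrated n = identity_complex {n} {}"
  by (simp add: concentrated_def identity_complex_def)

text \<open>The carrier in degree \<open>m\<close> of the Dold-Kan image of
  \<open>identity_complex P D\<close>. It does not depend on \<open>D\<close> and grows with
  \<open>P\<close>.\<close>

definition surj_family :: "nat set \<Rightarrow> nat \<Rightarrow> (nat \<times> (nat \<Rightarrow> nat) \<Rightarrow> 'a::ab_group_add) set" where
  "surj_family P m = {y \<in> extensional (delta_surj m).
     \<forall>p \<eta>. (p, \<eta>) \<in> delta_surj m \<longrightarrow> p \<notin> P \<longrightarrow> y (p, \<eta>) = 0}"

lemma comm_group_additive_group: "comm_group (additive_group :: 'a::ab_group_add monoid)"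
proof (rule comm_groupI)
  fix x :: 'a assume "x \<in> carrier additive_group"
  show "\<exists>y\<in>carrier additive_group. y \<otimes>\<^bsub>additive_group\<^esub> x = \<one>\<^bsub>additive_group\<^esub>"
    by (rule bexI[of _ "- x"]) (auto simp: additive_group_def)
qed (auto simp: additive_group_def add.assoc add.commute)

lemma comm_group_identity_complex: "comm_group (cgrp (identity_complex P D) p)"
  by (simp add: identity_complex_def comm_group_additive_group)

lemma carrier_identity_complex:
  "carrier (cgrp (identity_complex P D :: 'a::ab_group_add chain_complex) p) = (if p \<in> P then UNIV else {0})"
  by (simp add: identity_complex_def additive_group_def singleton_group_def)

lemma one_identity_complex: "\<one>\<^bsub>cgrp (identity_complex P D) p\<^esub> = 0"
  by (simp add: identity_complex_def additive_group_def singleton_group_def)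

lemma mult_identity_complex:
  assumes "a \<in> carrier (cgrp (identity_complex P D) p)" "b \<in> carrier (cgrp (identity_complex P D) p)"
  shows "a \<otimes>\<^bsub>cgrp (identity_complex P D) p\<^esub> b = a + b"
  using assms by (auto simp: identity_complex_def additive_group_def singleton_group_def)

lemma finprod_identity_complex:
  assumes "finite A" "\<And>x. x \<in> A \<Longrightarrow> g x \<in> carrier (cgrp (identity_complex P D) q)"
  shows "finprod (cgrp (identity_complex P D) q) g A = sum g A"
  using assms
proof (induction A rule: finite_induct)
  interpret comm_group "cgrp (identity_complex P D) q :: 'b monoid"
    by (rule comm_group_identity_complex)
  {
    case empty
    then show ?case by (simp add: one_identity_complex)
  next
    case (insert x A)
    then have "finprod (cgrp (identity_complex P D) q) g A \<in> carrier (cgrp (identity_complex P D) q)"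
      by (intro finprod_closed) auto
    with insert show ?case
      by (subst finprod_insert) (auto simp: mult_identity_complex)
  }
qed

lemma carrier_dold_kan_identity_complex:
  "carrier (sgrp (dold_kan (identity_complex P D)) m) = surj_family P m"
proof -
  have "group (case z of (p, \<eta>) \<Rightarrow> cgrp (identity_complex P D) p)" for z :: "nat \<times> (nat \<Rightarrow> nat)"
    using comm_group_identity_complex by (auto simp: comm_group_def split: prod.split)
  note * = carrier_sum_group[OF this]
  show ?thesis
    by (auto simp: dold_kan_def * surj_family_def PiE_iff carrier_identity_complex finite_delta_surj
        split: if_splits)
qed

lemma mult_dold_kan_identity_complex:
  assumes "y \<in> surj_family P m" "y' \<in> surj_family P m"
  shows "y \<otimes>\<^bsub>sgrp (dold_kan (identity_complex P D)) m\<^esub> y' = (\<lambda>z\<in>delta_surj m. y z + y' z)"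
proof -
  have "y (p, \<eta>) \<otimes>\<^bsub>cgrp (identity_complex P D) p\<^esub> y' (p, \<eta>) = y (p, \<eta>) + y' (p, \<eta>)"
    if "(p, \<eta>) \<in> delta_surj m" for p \<eta>
    using that assms by (intro mult_identity_complex) (auto simp: carrier_identity_complex surj_family_def)
  then show ?thesis
    by (auto simp: dold_kan_def intro!: restrict_ext)
qed

lemma comm_group_dold_kan_identity_complex:
  "comm_group (sgrp (dold_kan (identity_complex P D)) m)"
proof -
  have g: "group (sgrp (dold_kan (identity_complex P D)) m)"
    using comm_group_identity_complex[of P D]
    by (auto simp: dold_kan_def comm_group_def split: prod.split intro!: sum_group)
  show ?thesis
    by (rule group.group_comm_groupI[OF g])
      (simp add: carrier_dold_kan_identity_complex mult_dold_kan_identity_complex add.commute)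
qed

definition identity_coeff :: "nat set \<Rightarrow> nat \<Rightarrow> nat \<Rightarrow> (nat \<Rightarrow> nat) \<Rightarrow> 'a \<Rightarrow> 'a::ab_group_add" where
  "identity_coeff D q p \<mu> a =
    (if q = p \<or> p = Suc q \<and> \<mu> = (\<lambda>i\<in>{..q}. Suc i) \<and> p \<in> D then a else 0)"

text \<open>The condition on \<open>D\<close> says that identity differentials end in degrees
  carrying the group. Hence all factors lie in the carrier, where the product is an ordinary
  sum.\<close>

lemma sact_identity_complex:
  assumes y: "y \<in> surj_family P m" and D: "\<And>p. Suc p \<in> D \<Longrightarrow> p \<in> P" and z: "(q, \<theta>) \<in> delta_surj l"
  shows "sact (dold_kan (identity_complex P D)) l m \<alpha> y (q, \<theta>) =
    (\<Sum>(p, \<eta>, \<mu>)\<in>factorisations l m \<alpha> (q, \<theta>). identity_coeff D q p \<mu> (y (p, \<eta>)))"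
proof -
  have eq: "dk_mono (identity_complex P D) q p \<mu> a = identity_coeff D q p \<mu> a" for p \<mu> a
    by (auto simp: dk_mono_def identity_coeff_def one_identity_complex)
       (auto simp: identity_complex_def)
  have "(\<lambda>(p, \<eta>, \<mu>). identity_coeff D q p \<mu> (y (p, \<eta>))) w \<in> carrier (cgrp (identity_complex P D) q)"
    if "w \<in> factorisations l m \<alpha> (q, \<theta>)" for w
    using that y D by (auto simp: carrier_identity_complex identity_coeff_def factorisations_def surj_family_def)
  then have "finprod (cgrp (identity_complex P D) q)
        (\<lambda>(p, \<eta>, \<mu>). identity_coeff D q p \<mu> (y (p, \<eta>))) (factorisations l m \<alpha> (q, \<theta>)) =
      (\<Sum>(p, \<eta>, \<mu>)\<in>factorisations l m \<alpha> (q, \<theta>). identity_coeff D q p \<mu> (y (p, \<eta>)))"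
    by (rule finprod_identity_complex[OF finite_factorisations])
  then show ?thesis
    using z by (simp add: dold_kan_def eq factorisations_def)
qed

lemma sact_extensional:
  "sact (dold_kan C) l m \<alpha> y \<in> extensional (delta_surj l)"
  by (simp add: dold_kan_def)

lemma sact_in_surj_family:
  assumes "y \<in> surj_family P m" "\<And>p. Suc p \<in> D \<Longrightarrow> p \<in> P"
  shows "sact (dold_kan (identity_complex P D)) l m \<alpha> y \<in> surj_family P l"
proof -
  have "sact (dold_kan (identity_complex P D)) l m \<alpha> y (q, \<theta>) = 0" if "(q, \<theta>) \<in> delta_surj l" "q \<notin> P" for q \<theta>
  proof -
    have "(\<Sum>(p, \<eta>, \<mu>)\<in>factorisations l m \<alpha> (q, \<theta>). identity_coeff D q p \<mu> (y (p, \<eta>))) = 0"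
      using assms that
      by (intro sum.neutral) (auto simp: identity_coeff_def factorisations_def surj_family_def)
    then show ?thesis using sact_identity_complex[of y P m D q \<theta> l \<alpha>] assms that by simp
  qed
  then show ?thesis by (simp add: surj_family_def sact_extensional)
qed

lemma surj_family_add:
  "y \<in> surj_family P m \<Longrightarrow> y' \<in> surj_family P m \<Longrightarrow> (\<lambda>z\<in>delta_surj m. y z + y' z) \<in> surj_family P m"
  by (simp add: surj_family_def)

lemma sact_identity_complex_hom:
  assumes D: "\<And>p. Suc p \<in> D \<Longrightarrow> p \<in> P"
  shows "sact (dold_kan (identity_complex P D)) l m \<alpha> \<in>
    hom (sgrp (dold_kan (identity_complex P D)) m) (sgrp (dold_kan (identity_complex P D)) l)"
proof (rule homI)
  let ?X = "dold_kan (identity_complex P D) :: (nat \<times> (nat \<Rightarrow> nat) \<Rightarrow> 'a) simp_group"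
  fix y y' assume "y \<in> carrier (sgrp ?X m)" "y' \<in> carrier (sgrp ?X m)"
  then have yy: "y \<in> surj_family P m" "y' \<in> surj_family P m"
    by (simp_all add: carrier_dold_kan_identity_complex)
  have "sact ?X l m \<alpha> (\<lambda>z\<in>delta_surj m. y z + y' z) = (\<lambda>z\<in>delta_surj l. sact ?X l m \<alpha> y z + sact ?X l m \<alpha> y' z)"
  proof (rule extensionalityI[OF sact_extensional])
    fix z assume z: "z \<in> delta_surj l"
    obtain q \<theta> where [simp]: "z = (q, \<theta>)" by force
    have "identity_coeff D q p \<mu> (a + b) = identity_coeff D q p \<mu> a + identity_coeff D q p \<mu> b" for p \<mu> and a b :: 'a
      by (auto simp: identity_coeff_def)
    then show "sact ?X l m \<alpha> (\<lambda>z\<in>delta_surj m. y z + y' z) z =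
        (\<lambda>z\<in>delta_surj l. sact ?X l m \<alpha> y z + sact ?X l m \<alpha> y' z) z"
      using z yy D
      by (simp add: sact_identity_complex surj_family_add sum.distrib[symmetric])
         (intro sum.cong, auto simp: factorisations_def)
  qed simp
  then show "sact ?X l m \<alpha> (y \<otimes>\<^bsub>sgrp ?X m\<^esub> y') = sact ?X l m \<alpha> y \<otimes>\<^bsub>sgrp ?X l\<^esub> sact ?X l m \<alpha> y'"
    using yy D by (simp add: mult_dold_kan_identity_complex sact_in_surj_family)
qed (use D in \<open>simp add: carrier_dold_kan_identity_complex sact_in_surj_family\<close>)


section \<open>Functions on the nonempty subsets of \<open>{0, \<dots>, m}\<close>\<close>

definition hits :: "nat \<Rightarrow> nat \<Rightarrow> nat set \<Rightarrow> bool" where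
  "hits k p W \<longleftrightarrow> p = k \<and> W = {..p} \<or> p = Suc k \<and> W = {1..p}"

text \<open>This is \<open>E(A, k)\<close>, built from the acyclic complex given by the identity of
  \<open>A\<close> from degree \<open>k + 1\<close> to \<open>k\<close>.\<close>

definition elementary :: "nat \<Rightarrow> (nat \<times> (nat \<Rightarrow> nat) \<Rightarrow> 'a::ab_group_add) simp_group" where
  "elementary k = dold_kan (identity_complex {k, Suc k} {Suc k})"

text \<open>The embedding of \<open>E(A, k)\<close> into the functions on nonempty subsets. The indicators of
  \<open>{..k}\<close> and of \<open>{1..Suc k}\<close> span the normalised chains of the latter in degrees \<open>k\<close> and
  \<open>k + 1\<close> that are matched by the differential.\<close>

definition subset_fun ::
    "nat \<Rightarrow> nat \<Rightarrow> (nat \<times> (nat \<Rightarrow> nat) \<Rightarrow> 'a::ab_group_add) \<Rightarrow> nat set \<Rightarrow> 'a" where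
  "subset_fun m k y T = (\<Sum>(p, \<eta>)\<in>delta_surj m. if hits k p (\<eta> ` T) then y (p, \<eta>) else 0)"

lemma subset_fun_add:
  "subset_fun m k (\<lambda>z\<in>delta_surj m. y z + y' z) T = subset_fun m k y T + subset_fun m k y' T"
  unfolding subset_fun_def sum.distrib[symmetric] by (intro sum.cong) auto

lemma subset_fun_diff:
  "subset_fun m k (\<lambda>z\<in>delta_surj m. y z - y' z) T = subset_fun m k y T - subset_fun m k y' T"
  unfolding subset_fun_def sum_subtractf[symmetric] by (intro sum.cong) auto

lemma subset_fun_zero: "subset_fun m k (\<lambda>z\<in>delta_surj m. 0) T = 0"
  unfolding subset_fun_def by (intro sum.neutral) auto

text \<open>This matches \<open>hits\<close> with the coefficients of the Dold-Kan action. For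
  \<open>q < p\<close> the image of \<open>V\<close> has at most \<open>p\<close> elements, so it
  can only be \<open>{1..p}\<close>; then \<open>V\<close> is everything and \<open>\<mu>\<close> is
  the face missing 0, on which the differential acts.\<close>

lemma hits_image_inj:
  assumes \<mu>: "\<mu> \<in> delta_hom q p" "inj_on \<mu> {..q}" and V: "V \<subseteq> {..q}"
  shows "hits k p (\<mu> ` V) \<longleftrightarrow>
    hits k q V \<and> (q = p \<or> p = Suc q \<and> \<mu> = (\<lambda>i\<in>{..q}. Suc i) \<and> p \<in> {Suc k})"
proof (cases "q = p")
  case True
  then have "\<mu> ` V = (\<lambda>j. j) ` V"
    using delta_inj_endo[of \<mu> q] \<mu> V by (intro image_cong) auto
  then show ?thesis using True by simp
next
  case False
  then have qp: "q < p" using delta_inj_degree_le[OF \<mu>] by simp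
  have "finite V" using V finite_subset by blast
  then have cardV: "card (\<mu> ` V) \<le> card V" "card V \<le> Suc q"
    using card_image_le card_mono[OF _ V] by fastforce+
  show ?thesis
  proof
    assume h: "hits k p (\<mu> ` V)"
    have "\<mu> ` V \<noteq> {..p}"
      using cardV qp by auto
    with h have p: "p = Suc k" "\<mu> ` V = {1..p}" by (auto simp: hits_def)
    then have pq: "p = Suc q" "card V = Suc q" using cardV qp by auto
    then have V_eq: "V = {..q}" using V by (intro card_subset_eq) auto
    have "\<mu> j = Suc j" if j: "j \<le> q" for j
    proof -
      have im: "\<mu> ` {..q} = {1..Suc q}" using p pq V_eq by simp
      then have "1 \<le> \<mu> j" "\<mu> j \<le> Suc q" using j by auto
      then have "{w \<in> \<mu> ` {..q}. w < \<mu> j} = {1..<\<mu> j}" using im by auto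
      then show ?thesis using delta_inj_rank[OF \<mu> j] \<open>1 \<le> \<mu> j\<close> by simp
    qed
    then have "\<mu> = (\<lambda>i\<in>{..q}. Suc i)"
      using delta_homD(2)[OF \<mu>(1)] by (intro extensionalityI[of \<mu> "{..q}"]) (auto simp: PiE_iff)
    then show "hits k q V \<and> (q = p \<or> p = Suc q \<and> \<mu> = (\<lambda>i\<in>{..q}. Suc i) \<and> p \<in> {Suc k})"
      using p pq V_eq by (simp add: hits_def)
  next
    assume "hits k q V \<and> (q = p \<or> p = Suc q \<and> \<mu> = (\<lambda>i\<in>{..q}. Suc i) \<and> p \<in> {Suc k})"
    then have "q = k" "p = Suc q" "V = {..q}" "\<mu> = (\<lambda>i\<in>{..q}. Suc i)"
      using False by (auto simp: hits_def)
    moreover from this have "\<mu> ` V = Suc ` {..q}" by simp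
    then have "\<mu> ` V = {1..Suc q}" by (simp add: atMost_atLeast0 del: image_Suc_atMost)
    ultimately show "hits k p (\<mu> ` V)" by (simp add: hits_def)
  qed
qed

lemma hits_atLeast_1: "hits k p W \<Longrightarrow> {1..p} \<subseteq> W"
  unfolding hits_def by fastforce

lemma hits_zero_iff: "hits k p W \<Longrightarrow> if 0 \<in> W then p = k else p = Suc k"
  unfolding hits_def by fastforce

text \<open>Under the embedding the action becomes precomposition with direct images. Expanding it
  gives a sum over factorisations, which \<open>hits_image_inj\<close> and
  \<open>sum_factorisations\<close> collapse to one over \<open>(p, \<eta>)\<close>.\<close>

lemma subset_fun_natural:
  assumes y: "y \<in> surj_family {k, Suc k} m" and \<alpha>: "\<alpha> \<in> delta_hom l m" and T: "T \<subseteq> {..l}"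
  shows "subset_fun l k (sact (elementary k) l m \<alpha> y) T = subset_fun m k y (\<alpha> ` T)"
proof -
  have "subset_fun l k (sact (elementary k) l m \<alpha> y) T =
    (\<Sum>z\<in>delta_surj l. \<Sum>w\<in>factorisations l m \<alpha> z. case (z, w) of ((q, \<theta>), p, \<eta>, \<mu>) \<Rightarrow>
       if hits k q (\<theta> ` T) then identity_coeff {Suc k} q p \<mu> (y (p, \<eta>)) else 0)"
    unfolding subset_fun_def elementary_def
  proof (rule sum.cong[OF refl])
    fix z assume "z \<in> delta_surj l"
    moreover obtain q \<theta> where z: "z = (q, \<theta>)" by force
    ultimately show "(case z of (q, \<theta>) \<Rightarrow> if hits k q (\<theta> ` T)
        then sact (dold_kan (identity_complex {k, Suc k} {Suc k})) l m \<alpha> y (q, \<theta>) else 0) =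
      (\<Sum>w\<in>factorisations l m \<alpha> z. case (z, w) of ((q, \<theta>), p, \<eta>, \<mu>) \<Rightarrow>
       if hits k q (\<theta> ` T) then identity_coeff {Suc k} q p \<mu> (y (p, \<eta>)) else 0)"
      using sact_identity_complex[of y "{k, Suc k}" m "{Suc k}" q \<theta> l \<alpha>] y by simp
  qed
  also have "\<dots> = (\<Sum>z\<in>delta_surj m. case z of (p, \<eta>) \<Rightarrow> if hits k p (\<eta> ` \<alpha> ` T) then y (p, \<eta>) else 0)"
  proof (rule sum_factorisations[OF \<alpha>])
    fix q \<theta> p \<eta> \<mu>
    assume z: "(q, \<theta>) \<in> delta_surj l" and w: "(p, \<eta>, \<mu>) \<in> factorisations l m \<alpha> (q, \<theta>)"
    have \<mu>: "\<mu> \<in> delta_hom q p" "inj_on \<mu> {..q}" and eq: "compose {..l} \<eta> \<alpha> = compose {..l} \<mu> \<theta>"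
      using w by (auto simp: factorisations_def)
    have "\<theta> ` T \<subseteq> {..q}" using T delta_surjD(2)[OF z] by blast
    note * = hits_image_inj[OF \<mu> this, of k]
    have "\<eta> (\<alpha> t) = \<mu> (\<theta> t)" if "t \<in> T" for t
      using fun_cong[OF eq, of t] T that by (auto simp: compose_def)
    then have "\<eta> ` \<alpha> ` T = \<mu> ` \<theta> ` T" unfolding image_image by (intro image_cong) auto
    then show "(case ((q, \<theta>), p, \<eta>, \<mu>) of ((q, \<theta>), p, \<eta>, \<mu>) \<Rightarrow>
         if hits k q (\<theta> ` T) then identity_coeff {Suc k} q p \<mu> (y (p, \<eta>)) else 0) =
        (case (p, \<eta>) of (p, \<eta>) \<Rightarrow> if hits k p (\<eta> ` \<alpha> ` T) then y (p, \<eta>) else 0)"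
      using * by (auto simp: identity_coeff_def)
  qed
  finally show ?thesis by (simp add: subset_fun_def)
qed


subsection \<open>Uniqueness of coefficients\<close>

lemma delta_surj_zero:
  assumes "(p, \<eta>) \<in> delta_surj m" shows "\<eta> 0 = 0"
proof -
  have "0 \<in> \<eta> ` {..m}" using delta_surjD(2)[OF assms] by simp
  then obtain t where "t \<le> m" "\<eta> t = 0" by auto
  then show ?thesis using monotone_onD[OF delta_surjD(3)[OF assms], of 0 t] by simp
qed

text \<open>Least preimages give, besides a monotone section, the inequality
  \<open>\<epsilon> (\<eta> t) \<le> t\<close>, which later compares \<open>\<eta>\<close> pointwise
  with other surjections that have the same section.\<close>

lemma delta_surj_least_section:
  assumes "(p, \<eta>) \<in> delta_surj m"
  obtains \<epsilon> where "\<epsilon> \<in> delta_hom p m" "\<And>i. i \<le> p \<Longrightarrow> \<eta> (\<epsilon> i) = i" "\<And>t. t \<le> m \<Longrightarrow> \<epsilon> (\<eta> t) \<le> t"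
proof
  define \<epsilon> where "\<epsilon> = (\<lambda>i\<in>{..p}. LEAST t. t \<le> m \<and> \<eta> t = i)"
  have \<epsilon>: "\<epsilon> i \<le> m \<and> \<eta> (\<epsilon> i) = i" if "i \<le> p" for i
  proof -
    have "i \<in> \<eta> ` {..m}" using that delta_surjD(2)[OF assms] by simp
    then have "\<exists>t. t \<le> m \<and> \<eta> t = i" by auto
    from LeastI_ex[OF this] show ?thesis using that by (simp add: \<epsilon>_def)
  qed
  then show "\<eta> (\<epsilon> i) = i" if "i \<le> p" for i using that by blast
  show "\<epsilon> (\<eta> t) \<le> t" if "t \<le> m" for t
  proof -
    have "\<eta> t \<le> p" using that delta_surjD(2)[OF assms] by blast
    then show ?thesis using that by (simp add: \<epsilon>_def Least_le)
  qed
  have "\<epsilon> i \<le> \<epsilon> j" if "i \<le> j" "j \<le> p" for i j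
  proof (rule ccontr)
    assume "\<not> \<epsilon> i \<le> \<epsilon> j"
    moreover from this have "j \<le> i"
      using monotone_onD[OF delta_surjD(3)[OF assms], of "\<epsilon> j" "\<epsilon> i"] \<epsilon>[of i] \<epsilon>[of j] that by simp
    ultimately show False using that by simp
  qed
  then show "\<epsilon> \<in> delta_hom p m"
    using \<epsilon> by (auto simp: delta_hom_def monotone_on_def PiE_iff) (simp add: \<epsilon>_def)
qed

text \<open>Among the nonzero coefficients in degrees in \<open>P\<close>, take \<open>(i, p, \<eta>)\<close> with \<open>\<eta>\<close> of maximal
  total value, and evaluate on the corner cube transported along the least section of \<open>\<eta>\<close>.
  Modulo cubes of degree less than \<open>p\<close> only its own term survives.\<close>

lemma coefficients_vanish:
  fixes x :: "nat \<Rightarrow> nat \<times> (nat \<Rightarrow> nat) \<Rightarrow> 'a::ab_group_add"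
  assumes I: "finite I" and x: "\<And>i. i \<in> I \<Longrightarrow> x i \<in> surj_family {i, Suc i} m"
    and low: "\<And>p B \<sigma>. p \<in> P \<Longrightarrow> B \<in> degenerable p \<Longrightarrow> \<sigma> \<in> delta_hom p m \<Longrightarrow>
      (\<lambda>u\<in>cube p. \<Sum>i\<in>I. subset_fun m i (x i) (\<sigma> ` B u)) \<in> low_degree p p"
    and "i \<in> I" "(p, \<eta>) \<in> delta_surj m" "p \<in> P"
  shows "x i (p, \<eta>) = 0"
proof (rule ccontr)
  assume "x i (p, \<eta>) \<noteq> 0"
  define Z where "Z = {(i, p, \<eta>). i \<in> I \<and> (p, \<eta>) \<in> delta_surj m \<and> p \<in> P \<and> x i (p, \<eta>) \<noteq> 0}"
  define \<omega> where "\<omega> = (\<lambda>(i :: nat, p :: nat, \<eta> :: nat \<Rightarrow> nat). \<Sum>t\<le>m. \<eta> t)"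
  have "(i, p, \<eta>) \<in> Z" using assms \<open>x i (p, \<eta>) \<noteq> 0\<close> by (simp add: Z_def)
  moreover have "finite Z"
    by (rule finite_subset[of _ "I \<times> delta_surj m"]) (auto simp: Z_def I finite_delta_surj)
  ultimately have "\<exists>z\<in>Z. \<forall>z'\<in>Z. \<omega> z' \<le> \<omega> z"
    using Max_in[of "\<omega> ` Z"] Max_ge[of "\<omega> ` Z"] by fastforce
  then obtain i p \<eta> where Z: "(i, p, \<eta>) \<in> Z"
    and max: "\<And>i' p' \<eta>'. (i', p', \<eta>') \<in> Z \<Longrightarrow> (\<Sum>t\<le>m. \<eta>' t) \<le> (\<Sum>t\<le>m. \<eta> t)"
    by (force simp: \<omega>_def)
  have i: "i \<in> I" and s: "(p, \<eta>) \<in> delta_surj m" and pP: "p \<in> P" and nz: "x i (p, \<eta>) \<noteq> 0"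
    using Z by (auto simp: Z_def)
  have pi: "p = i \<or> p = Suc i" using x[OF i] s nz by (auto simp: surj_family_def)
  obtain \<epsilon> where \<epsilon>: "\<epsilon> \<in> delta_hom p m" "\<And>i. i \<le> p \<Longrightarrow> \<eta> (\<epsilon> i) = i" "\<And>t. t \<le> m \<Longrightarrow> \<epsilon> (\<eta> t) \<le> t"
    using delta_surj_least_section[OF s] by blast
  have \<epsilon>0: "\<epsilon> 0 = 0" using \<epsilon>(3)[of 0] delta_surj_zero[OF s] by simp
  \<comment> \<open>The top label has to be the set that \<open>hits\<close> prescribes for
    \<open>(i, p)\<close>: \<open>{..p}\<close> if \<open>p = i\<close>, and \<open>{1..p}\<close>
    if \<open>p = Suc i\<close>.\<close>
  define B where "B = corner_cube (p = i) p"
  have zp: "(p = i) \<or> 0 < p" using pi by auto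
  have B: "B \<in> degenerable p" unfolding B_def by (rule corner_cube_degenerable[OF zp])
  have Bsub: "B u \<subseteq> {..p}" if "u \<in> cube p" for u
    using corner_cube_bounded[OF that] by (simp add: B_def)
  have Bfull: "{1..p} \<subseteq> B u \<longleftrightarrow> (\<forall>j<p. u j = 1)" if "u \<in> cube p" for u
    using corner_cube_full_iff[OF that] by (simp add: B_def)
  have B0: "0 \<in> B u \<longleftrightarrow> p = i" if "u \<in> cube p" "{1..p} \<subseteq> B u" for u
    using zero_in_corner_cube[of u p "p = i"] that zp by (simp add: B_def)
  define contrib where "contrib = (\<lambda>(i', p', \<eta>') u. if hits i' p' (\<eta>' ` \<epsilon> ` B u) then x i' (p', \<eta>') else 0)"
  have split: "(\<Sum>i\<in>I. subset_fun m i (x i) (\<epsilon> ` B u)) =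
      contrib (i, p, \<eta>) u + (\<Sum>z\<in>I \<times> delta_surj m - {(i, p, \<eta>)}. contrib z u)" for u
  proof -
    have "(\<Sum>i\<in>I. subset_fun m i (x i) (\<epsilon> ` B u)) = (\<Sum>i\<in>I. \<Sum>z\<in>delta_surj m. contrib (i, z) u)"
      by (auto simp: subset_fun_def contrib_def intro!: sum.cong)
    also have "\<dots> = (\<Sum>z\<in>I \<times> delta_surj m. contrib z u)"
      by (simp add: sum.cartesian_product)
    finally show ?thesis
      using i s I by (simp add: sum.remove[of _ "(i, p, \<eta>)"] finite_delta_surj)
  qed
  have rest: "(\<lambda>u\<in>cube p. contrib z u) \<in> low_degree p p" if z: "z \<in> I \<times> delta_surj m - {(i, p, \<eta>)}" for z
  proof -
    obtain i' p' \<eta>' where zeq: "z = (i', p', \<eta>')" by (metis prod.exhaust)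
    have i': "i' \<in> I" and s': "(p', \<eta>') \<in> delta_surj m" and ne: "(i', p', \<eta>') \<noteq> (i, p, \<eta>)"
      using z zeq by auto
    define \<tau> where "\<tau> = (\<lambda>j. \<eta>' (\<epsilon> j))"
    have contrib_eq: "contrib z u = (if hits i' p' (\<tau> ` B u) then x i' (p', \<eta>') else 0)" for u
      by (simp add: contrib_def zeq \<tau>_def image_image)
    \<comment> \<open>If \<open>\<tau>\<close> repeats a value, the term ignores one coordinate and
      its degree drops; if \<open>\<tau>\<close> is injective, the term vanishes
      identically.\<close>
    show ?thesis
    proof (cases "\<exists>j<p. \<tau> j = \<tau> (Suc j)")
      case True
      then obtain j where j: "j < p" "\<tau> j = \<tau> (Suc j)" by blast
      show ?thesis
      proof (rule low_degree_if_few_coordinates)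
        show "{..<p} - {j} \<subseteq> {..<p}" "card ({..<p} - {j}) < p" using j(1) by auto
        fix u v assume uv: "u \<in> cube p" "v \<in> cube p" "\<And>k. k \<in> {..<p} - {j} \<Longrightarrow> u k = v k"
        have "\<tau> ` B u = \<tau> ` B v"
        proof (rule degenerable_image_depends_on_jumps[OF B uv(1,2)])
          fix k assume "k < p" "\<tau> k \<noteq> \<tau> (Suc k)"
          then show "u k = v k" using j(2) by (intro uv(3)) auto
        qed
        then show "contrib z u = contrib z v" by (simp add: contrib_eq)
      qed
    next
      case False
      have comp: "compose {..p} \<eta>' \<epsilon> \<in> delta_hom p p'"
        by (rule delta_hom_compose[OF \<epsilon>(1) delta_surjD(1)[OF s']])
      have \<tau>_eq: "compose {..p} \<eta>' \<epsilon> j = \<tau> j" if "j \<le> p" for j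
        using that by (simp add: compose_def \<tau>_def)
      have step: "\<tau> j < \<tau> (Suc j)" if "j < p" for j
        using False that monotone_onD[OF delta_homD(1)[OF comp], of j "Suc j"] \<tau>_eq[of j] \<tau>_eq[of "Suc j"]
        by (intro le_neq_implies_less) (simp_all add: Suc_leI)
      have less: "\<tau> j < \<tau> k" if "j < k" "k \<le> p" for j k
        using that
      proof (induction k)
        case (Suc k)
        then show ?case using step[of k] by (cases "j = k") auto
      qed simp
      have inj: "inj_on (compose {..p} \<eta>' \<epsilon>) {..p}"
        by (rule linorder_inj_onI') (use less \<tau>_eq in force)
      have "contrib z u = 0" if u: "u \<in> cube p" for u
      proof (rule ccontr)
        assume "contrib z u \<noteq> 0"
        then have h: "hits i' p' (\<tau> ` B u)" and nz': "x i' (p', \<eta>') \<noteq> 0"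
          by (auto simp: contrib_eq split: if_splits)
        \<comment> \<open>A hit makes \<open>\<tau>\<close> surject onto \<open>{..p'}\<close>;
          being injective as well, it is the identity.\<close>
        have "\<tau> 0 = 0" using delta_surj_zero[OF s'] by (simp add: \<tau>_def \<epsilon>0)
        then have "0 \<in> \<tau> ` {..p}" by force
        moreover have "{1..p'} \<subseteq> \<tau> ` B u" by (rule hits_atLeast_1[OF h])
        then have "{1..p'} \<subseteq> \<tau> ` {..p}" using Bsub[OF u] by blast
        moreover have "{..p'} = insert 0 {1..p'}" by auto
        ultimately have "{..p'} \<subseteq> \<tau> ` {..p}" by simp
        then have "Suc p' \<le> Suc p"
          using card_mono[of "\<tau> ` {..p}" "{..p'}"] card_image_le[of "{..p}" \<tau>] by simp
        then have p': "p' = p" using delta_inj_degree_le[OF comp inj] by simp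
        have \<tau>_id: "\<tau> j = j" if "j \<le> p" for j
          using delta_inj_endo[of "compose {..p} \<eta>' \<epsilon>" p j] comp inj p' that \<tau>_eq by simp
        \<comment> \<open>Now \<open>\<epsilon>\<close> is a section of \<open>\<eta>'\<close> too,
          and it takes least preimages under \<open>\<eta>\<close>. So \<open>\<eta>'\<close>
          dominates \<open>\<eta>\<close>, and maximality forces equality.\<close>
        have le: "\<eta> t \<le> \<eta>' t" if "t \<le> m" for t
        proof -
          have "\<eta> t \<le> p" using that delta_surjD(2)[OF s] by blast
          then have "\<eta> t = \<eta>' (\<epsilon> (\<eta> t))" using \<tau>_id[of "\<eta> t"] by (simp add: \<tau>_def)
          also have "\<dots> \<le> \<eta>' t"
            using monotone_onD[OF delta_surjD(3)[OF s'], of "\<epsilon> (\<eta> t)" t] \<epsilon>(3)[OF that] that by simp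
          finally show ?thesis .
        qed
        have "(\<Sum>t\<le>m. \<eta>' t) \<le> (\<Sum>t\<le>m. \<eta> t)"
          using i' s' p' pP nz' by (intro max[of i' p']) (simp add: Z_def)
        with sum_mono[of "{..m}" \<eta> \<eta>'] le have "(\<Sum>t\<le>m. \<eta> t) = (\<Sum>t\<le>m. \<eta>' t)"
          by simp
        then have "\<eta> t = \<eta>' t" if "t \<le> m" for t
          using that le by (intro sum_mono_inv[of \<eta> "{..m}" \<eta>' t]) auto
        then have "\<eta>' = \<eta>"
          using delta_surjD(4)[OF s'] delta_surjD(4)[OF s]
          by (intro extensionalityI[of \<eta>' "{..m}" \<eta>]) (auto simp: PiE_iff)
        \<comment> \<open>The only competitor left has the same \<open>\<eta>\<close> and another
          index; whether 0 lies in the label tells the two indices apart.\<close>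
        with ne p' have ne: "i' \<noteq> i" by simp
        have "\<tau> ` B u = (\<lambda>j. j) ` B u"
          using Bsub[OF u] \<tau>_id by (intro image_cong) auto
        then have hB: "hits i' p (B u)" using h p' by simp
        then have "{1..p} \<subseteq> B u" by (rule hits_atLeast_1)
        from B0[OF u this] have "0 \<in> B u \<longleftrightarrow> p = i" .
        with hits_zero_iff[OF hB] show False using ne pi by (simp split: if_splits)
      qed
      then show ?thesis
        using low_degree_zero[of p p] by (simp cong: restrict_cong)
    qed
  qed
  have main: "contrib (i, p, \<eta>) u = (if \<forall>j<p. u j = 1 then x i (p, \<eta>) else 0)" if u: "u \<in> cube p" for u
  proof -
    have "\<eta> ` \<epsilon> ` B u = (\<lambda>j. j) ` B u"
      unfolding image_image using Bsub[OF u] \<epsilon>(2) by (intro image_cong) auto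
    moreover have "hits i p (B u) \<longleftrightarrow> {1..p} \<subseteq> B u"
    proof
      assume full: "{1..p} \<subseteq> B u"
      have "{..p} = insert 0 {1..p}" by auto
      then have "B u = (if 0 \<in> B u then {..p} else {1..p})"
        using full Bsub[OF u] by auto
      then show "hits i p (B u)" using B0[OF u full] pi by (auto simp: hits_def)
    qed (rule hits_atLeast_1)
    ultimately show ?thesis using Bfull[OF u] by (simp add: contrib_def)
  qed
  have "(\<lambda>u\<in>cube p. (\<Sum>i\<in>I. subset_fun m i (x i) (\<epsilon> ` B u)) +
      - (\<Sum>z\<in>I \<times> delta_surj m - {(i, p, \<eta>)}. contrib z u)) \<in> low_degree p p"
    by (intro low_degree_add low_degree_uminus low_degree_sum rest low pP B \<epsilon>(1))
  moreover have "(\<lambda>u\<in>cube p. (\<Sum>i\<in>I. subset_fun m i (x i) (\<epsilon> ` B u)) +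
      - (\<Sum>z\<in>I \<times> delta_surj m - {(i, p, \<eta>)}. contrib z u)) =
      (\<lambda>u\<in>cube p. if \<forall>j<p. u j = 1 then x i (p, \<eta>) else 0)"
    by (rule restrict_ext) (simp add: split main)
  ultimately show False
    using top_monomial_not_low_degree[of p "x i (p, \<eta>)"] nz by simp
qed

text \<open>The vanishing result is applied to the difference in all degrees: its function on
  \<open>Sub m\<close> is zero, hence of low degree on every test cube.\<close>

lemma subset_fun_inject:
  fixes x x' :: "nat \<Rightarrow> nat \<times> (nat \<Rightarrow> nat) \<Rightarrow> 'a::ab_group_add"
  assumes I: "finite I" and x: "\<And>i. i \<in> I \<Longrightarrow> x i \<in> surj_family {i, Suc i} m"
    and x': "\<And>i. i \<in> I \<Longrightarrow> x' i \<in> surj_family {i, Suc i} m"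
    and eq: "\<And>T. T \<in> Sub m \<Longrightarrow> (\<Sum>i\<in>I. subset_fun m i (x i) T) = (\<Sum>i\<in>I. subset_fun m i (x' i) T)"
    and i: "i \<in> I"
  shows "x i = x' i"
proof (rule extensionalityI[of _ "delta_surj m"])
  fix z assume z: "z \<in> delta_surj m"
  obtain p \<eta> where zeq: "z = (p, \<eta>)" by force
  define d where "d i = (\<lambda>z\<in>delta_surj m. x i z - x' i z)" for i
  have "d i (p, \<eta>) = 0"
  proof (rule coefficients_vanish[OF I, of d m UNIV])
    show "d i \<in> surj_family {i, Suc i} m" if "i \<in> I" for i
      using x[OF that] x'[OF that] by (simp add: d_def surj_family_def)
    fix p B \<sigma> assume B: "B \<in> degenerable p" and \<sigma>: "\<sigma> \<in> delta_hom p m"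
    have "(\<Sum>i\<in>I. subset_fun m i (d i) (\<sigma> ` B u)) = 0" if u: "u \<in> cube p" for u
    proof -
      have "\<sigma> ` B u \<in> Sub m"
        using K_cubes_Sub[OF image_degenerable_in_K_cubes[OF B \<sigma>] u] u by simp
      from eq[OF this] show ?thesis by (simp add: d_def subset_fun_diff sum_subtractf)
    qed
    then show "(\<lambda>u\<in>cube p. \<Sum>i\<in>I. subset_fun m i (d i) (\<sigma> ` B u)) \<in> low_degree p p"
      using low_degree_zero[of p p] by (simp cong: restrict_cong)
  qed (use i z zeq in auto)
  then show "x i z = x' i z" using z by (simp add: d_def zeq)
qed (use x[OF i] x'[OF i] in \<open>auto simp: surj_family_def\<close>)


subsection \<open>Existence of coefficients\<close>

text \<open>The surjection attached to \<open>S\<close>. It is constant on the blocks between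
  successive positive elements of \<open>S\<close>; 0 is not counted, so that it starts at 0 whether
  or not \<open>0 \<in> S\<close>.\<close>

definition rank :: "nat \<Rightarrow> nat set \<Rightarrow> nat \<Rightarrow> nat" where
  "rank m S = (\<lambda>t\<in>{..m}. card (S \<inter> {1..t}))"

lemma rank_less:
  assumes "s \<in> S" "t < s" "s \<le> m" shows "rank m S t < rank m S s"
proof -
  have "s \<in> S \<inter> {1..s}" "s \<notin> S \<inter> {1..t}" using assms by auto
  moreover have "S \<inter> {1..t} \<subseteq> S \<inter> {1..s}" using assms by auto
  ultimately have "card (S \<inter> {1..t}) < card (S \<inter> {1..s})"
    by (intro psubset_card_mono) auto
  then show ?thesis using assms by (simp add: rank_def)
qed

lemma inj_on_rank: "S \<subseteq> {..m} \<Longrightarrow> inj_on (rank m S) S"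
  by (rule linorder_inj_onI') (use rank_less in force)

lemma rank_image_positive:
  assumes "S \<subseteq> {..m}" shows "rank m S ` (S - {0}) = {1..rank m S m}"
proof (rule card_subset_eq)
  have eq: "S - {0} = S \<inter> {1..m}" using assms by auto
  have "inj_on (rank m S) (S - {0})" by (rule inj_on_subset[OF inj_on_rank[OF assms]]) auto
  then show "card (rank m S ` (S - {0})) = card {1..rank m S m}"
    by (simp only: card_image) (simp add: eq rank_def)
  show "rank m S ` (S - {0}) \<subseteq> {1..rank m S m}"
  proof
    fix r assume "r \<in> rank m S ` (S - {0})"
    then obtain s where s: "s \<in> S" "0 < s" "s \<le> m" "r = rank m S s" using assms by auto
    moreover have "rank m S 0 < rank m S s" using s by (intro rank_less)
    moreover have "card (S \<inter> {1..s}) \<le> card (S \<inter> {1..m})" using s by (intro card_mono) auto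
    ultimately show "r \<in> {1..rank m S m}" by (simp add: rank_def)
  qed
qed simp

lemma rank_zero: "rank m S 0 = 0"
  by (simp add: rank_def)

text \<open>These are the two shapes that \<open>hits\<close> allows, so every nonempty
  \<open>S\<close> selects a generator of some \<open>E(A, k)\<close>.\<close>

lemma rank_image:
  assumes "S \<subseteq> {..m}"
  shows "rank m S ` S = (if 0 \<in> S then {..rank m S m} else {1..rank m S m})"
proof (cases "0 \<in> S")
  case True
  then have "rank m S ` S = insert (rank m S 0) (rank m S ` (S - {0}))" by blast
  then show ?thesis using True rank_image_positive[OF assms] by (auto simp: rank_zero)
next
  case False
  then have "S - {0} = S" by blast
  then show ?thesis using False rank_image_positive[OF assms] by simp
qed

lemma rank_delta_surj:
  assumes "S \<subseteq> {..m}" shows "(rank m S m, rank m S) \<in> delta_surj m"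
proof -
  have mono: "rank m S s \<le> rank m S t" if "s \<le> t" "t \<le> m" for s t
    using that by (auto simp: rank_def intro!: card_mono)
  have "{..rank m S m} = insert (rank m S 0) (rank m S ` (S - {0}))"
    using rank_image_positive[OF assms] by (auto simp: rank_zero)
  also have "\<dots> \<subseteq> rank m S ` {..m}" using assms by blast
  finally have "rank m S ` {..m} = {..rank m S m}" using mono by auto
  moreover have "rank m S \<in> extensional {..m}" by (simp add: rank_def)
  ultimately show ?thesis
    using mono by (auto simp: delta_surj_def delta_hom_def PiE_iff monotone_on_def)
qed

text \<open>If \<open>T\<close> and \<open>S\<close> have the same ranks with respect to \<open>S\<close>, then \<open>T\<close> meets the blocks
  \<open>[s, s')\<close> between successive elements of \<open>S\<close>, so that \<open>T\<close> dominates \<open>S\<close> elementwise.\<close>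

lemma rank_image_eq_less:
  assumes S: "S \<subseteq> {..m}" and T: "T \<subseteq> {..m}" and eq: "rank m S ` T = rank m S ` S" and ne: "S \<noteq> T"
  shows "sum Suc S < sum Suc T"
proof -
  have fin: "finite S" "finite T" using S T finite_subset by blast+
  have "\<forall>s\<in>S. \<exists>t\<in>T. rank m S t = rank m S s"
    using eq by (metis imageE imageI)
  then obtain \<tau> where \<tau>: "\<And>s. s \<in> S \<Longrightarrow> \<tau> s \<in> T" "\<And>s. s \<in> S \<Longrightarrow> rank m S (\<tau> s) = rank m S s"
    using bchoice[of S "\<lambda>s t. t \<in> T \<and> rank m S t = rank m S s"] by blast
  have le: "s \<le> \<tau> s" if "s \<in> S" for s
    using rank_less[of s S "\<tau> s" m] \<tau>(2)[OF that] that S by (metis atMost_iff less_irrefl not_le subsetD)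
  have inj: "inj_on \<tau> S"
    using \<tau>(2) inj_on_rank[OF S] by (metis inj_onI inj_onD)
  have im: "\<tau> ` S \<subseteq> T" using \<tau>(1) by blast
  have sum_le: "sum Suc S \<le> (\<Sum>s\<in>S. Suc (\<tau> s))" using le by (intro sum_mono) simp
  have sum_eq: "(\<Sum>s\<in>S. Suc (\<tau> s)) = sum Suc (\<tau> ` S)" by (simp add: sum.reindex[OF inj])
  show ?thesis
  proof (cases "\<tau> ` S = T")
    case True
    then obtain s where "s \<in> S" "\<tau> s \<noteq> s" using ne by force
    then have "\<exists>s\<in>S. Suc s < Suc (\<tau> s)" using le[of s] by (intro bexI[of _ s]) auto
    then have "sum Suc S < (\<Sum>s\<in>S. Suc (\<tau> s))"
      using le fin(1) by (intro sum_strict_mono_ex1) auto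
    then show ?thesis using sum_eq True by simp
  next
    case False
    then obtain t where "t \<in> T - \<tau> ` S" using im by blast
    \<comment> \<open>\<open>Suc\<close> gives every element positive weight, so an extra element
      counts even when it is 0.\<close>
    then have "sum Suc (\<tau> ` S) < sum Suc T"
      using fin(2) im by (intro sum_strict_mono2[of T "\<tau> ` S" t]) auto
    then show ?thesis using sum_le sum_eq by simp
  qed
qed

text \<open>That \<open>T\<close> and \<open>S\<close> have the same image under
  \<open>rank m S\<close> is the hit condition of the generator of \<open>S\<close>, and this
  relation is unitriangular by \<open>rank_image_eq_less\<close>. The bound \<open>N\<close> stays
  free because summands above \<open>m\<close> contribute nothing and later comparisons need a
  common range.\<close>

lemma subset_fun_decomposition:
  fixes f :: "nat set \<Rightarrow> 'a::ab_group_add"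
  shows "\<exists>x. (\<forall>i. x i \<in> surj_family {i, Suc i} m) \<and>
    (\<forall>N\<ge>m. \<forall>T\<in>Sub m. f T = (\<Sum>i\<le>N. subset_fun m i (x i) T))"
proof -
  have fin: "finite (Sub m)" by (rule finite_subset[of _ "Pow {..m}"]) (auto simp: Sub_def)
  have sub: "S \<subseteq> {..m}" if "S \<in> Sub m" for S using that by (simp add: Sub_def)
  obtain c where c: "\<And>T. T \<in> Sub m \<Longrightarrow>
      f T = (\<Sum>S\<in>Sub m. if rank m S ` T = rank m S ` S then c S else 0)"
    using triangular_system_solvable[OF fin, of "\<lambda>S T. rank m S ` T = rank m S ` S" "sum Suc" f]
      rank_image_eq_less[OF sub sub] by blast
  \<comment> \<open>The generator of \<open>S\<close> lies in the lower degree of its summand if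
    \<open>0 \<in> S\<close>, and in the upper one otherwise.\<close>
  define key where "key S = ((if 0 \<in> S then rank m S m else rank m S m - 1), rank m S m, rank m S)" for S
  define x where "x i = (\<lambda>z\<in>delta_surj m. \<Sum>S | S \<in> Sub m \<and> key S = (i, z). c S)" for i
  \<comment> \<open>This keeps the subtraction in \<open>key\<close> from truncating.\<close>
  have pos: "0 < rank m S m" if "S \<in> Sub m" "0 \<notin> S" for S
    using that rank_image[OF sub[OF that(1)]] by (auto simp: Sub_def)
  have "x i \<in> surj_family {i, Suc i} m" for i
  proof -
    have "x i (p, \<eta>) = 0" if "(p, \<eta>) \<in> delta_surj m" "p \<noteq> i" "p \<noteq> Suc i" for p \<eta>
    proof -
      have "key S \<noteq> (i, p, \<eta>)" if "S \<in> Sub m" for S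
        using pos[OF that] \<open>p \<noteq> i\<close> \<open>p \<noteq> Suc i\<close> by (auto simp: key_def)
      then have "{S. S \<in> Sub m \<and> key S = (i, p, \<eta>)} = {}" by blast
      then have "(\<Sum>S | S \<in> Sub m \<and> key S = (i, p, \<eta>). c S) = 0" by (simp only: sum.empty)
      then show ?thesis using that(1) by (simp add: x_def)
    qed
    then show ?thesis by (simp add: surj_family_def) (simp add: x_def)
  qed
  moreover have "f T = (\<Sum>i\<le>N. subset_fun m i (x i) T)" if N: "m \<le> N" and T: "T \<in> Sub m" for N T
  proof -
    define h where "h = (\<lambda>(i, p, \<eta>). hits i p (\<eta> ` T))"
    have h_key: "h (key S) \<longleftrightarrow> rank m S ` T = rank m S ` S" if S: "S \<in> Sub m" for S
      unfolding rank_image[OF sub[OF S]] using pos[OF S] by (auto simp: h_def key_def hits_def)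
    have "(\<Sum>i\<le>N. subset_fun m i (x i) T) =
        (\<Sum>i\<le>N. \<Sum>z\<in>delta_surj m. \<Sum>S | S \<in> Sub m \<and> key S = (i, z). if h (key S) then c S else 0)"
      unfolding subset_fun_def by (intro sum.cong) (auto simp: x_def h_def)
    also have "\<dots> = (\<Sum>u\<in>{..N} \<times> delta_surj m. \<Sum>S | S \<in> Sub m \<and> key S = u. if h (key S) then c S else 0)"
      by (simp add: sum.cartesian_product split_beta)
    also have "\<dots> = (\<Sum>S\<in>Sub m. if h (key S) then c S else 0)"
    proof (rule sum.group[OF fin])
      show "key ` Sub m \<subseteq> {..N} \<times> delta_surj m"
      proof
        fix u assume "u \<in> key ` Sub m"
        then obtain S where S: "S \<in> Sub m" "u = key S" by blast
        have "(rank m S m, rank m S) \<in> delta_surj m" by (rule rank_delta_surj[OF sub[OF S(1)]])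
        then show "u \<in> {..N} \<times> delta_surj m"
          using N delta_surj_degree_le[of "rank m S m" "rank m S" m] S(2) by (auto simp: key_def)
      qed
    qed (simp add: finite_delta_surj)
    also have "\<dots> = f T" using c[OF T] h_key by (simp cong: sum.cong)
    finally show ?thesis by simp
  qed
  ultimately show ?thesis by blast
qed


section \<open>The contractible summands\<close>

lemma carrier_elementary: "carrier (sgrp (elementary k) m) = surj_family {k, Suc k} m"
  by (simp add: elementary_def carrier_dold_kan_identity_complex)

lemma sact_elementary_closed:
  "y \<in> surj_family {k, Suc k} m \<Longrightarrow> sact (elementary k) l m \<alpha> y \<in> surj_family {k, Suc k} l"
  unfolding elementary_def by (rule sact_in_surj_family) auto

lemma zero_in_surj_family: "(\<lambda>z\<in>delta_surj m. 0) \<in> surj_family P m"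
  by (simp add: surj_family_def)

lemma elementary_eqI:
  assumes "y \<in> surj_family {k, Suc k} m" "y' \<in> surj_family {k, Suc k} m"
    and "\<And>T. T \<in> Sub m \<Longrightarrow> subset_fun m k y T = subset_fun m k y' T"
  shows "y = y'"
  using subset_fun_inject[of "{k}" "\<lambda>_. y" m "\<lambda>_. y'" k] assms by simp

lemma image_in_Sub: "\<alpha> \<in> delta_hom l m \<Longrightarrow> T \<in> Sub l \<Longrightarrow> \<alpha> ` T \<in> Sub m"
  by (fastforce simp: Sub_def delta_hom_def PiE_iff)

text \<open>Functoriality is checked after the embedding, where it reduces to functoriality of
  direct images.\<close>

lemma simplicial_abelian_group_elementary: "simplicial_abelian_group (elementary k)"
proof -
  have comm: "comm_group (sgrp (elementary k) m)" for m
    unfolding elementary_def by (rule comm_group_dold_kan_identity_complex)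
  have hom: "sact (elementary k) l m \<alpha> \<in> hom (sgrp (elementary k) m) (sgrp (elementary k) l)" for l m \<alpha>
    unfolding elementary_def by (rule sact_identity_complex_hom) auto
  have ident: "sact (elementary k) m m (\<lambda>i\<in>{..m}. i) y = y" if y: "y \<in> surj_family {k, Suc k} m" for m y
  proof (rule elementary_eqI[OF sact_elementary_closed[OF y] y])
    fix T assume "T \<in> Sub m"
    then have T: "T \<subseteq> {..m}" by (simp add: Sub_def)
    have "(\<lambda>i\<in>{..m}. i) \<in> delta_hom m m" by (auto simp: delta_hom_def monotone_on_def)
    from subset_fun_natural[OF y this T]
    have "subset_fun m k (sact (elementary k) m m (\<lambda>i\<in>{..m}. i) y) T =
        subset_fun m k y ((\<lambda>i\<in>{..m}. i) ` T)" .
    also have "(\<lambda>i\<in>{..m}. i) ` T = id ` T" using T by (intro image_cong) auto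
    also have "\<dots> = T" by simp
    finally show "subset_fun m k (sact (elementary k) m m (\<lambda>i\<in>{..m}. i) y) T = subset_fun m k y T" .
  qed
  have comp: "sact (elementary k) l n (compose {..l} \<tau> \<sigma>) y =
      sact (elementary k) l m \<sigma> (sact (elementary k) m n \<tau> y)"
    if \<sigma>: "\<sigma> \<in> delta_hom l m" and \<tau>: "\<tau> \<in> delta_hom m n" and y: "y \<in> surj_family {k, Suc k} n"
    for l m n \<sigma> \<tau> y
  proof (rule elementary_eqI)
    fix T assume "T \<in> Sub l"
    then have T: "T \<subseteq> {..l}" by (simp add: Sub_def)
    have "\<sigma> ` T \<subseteq> {..m}" using T delta_homD(2)[OF \<sigma>] by blast
    moreover have "compose {..l} \<tau> \<sigma> ` T = \<tau> ` \<sigma> ` T"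
      unfolding image_image using T by (intro image_cong) (auto simp: compose_def)
    ultimately show "subset_fun l k (sact (elementary k) l n (compose {..l} \<tau> \<sigma>) y) T =
        subset_fun l k (sact (elementary k) l m \<sigma> (sact (elementary k) m n \<tau> y)) T"
      using y \<sigma> \<tau> T
      by (simp add: subset_fun_natural sact_elementary_closed delta_hom_compose)
  qed (use y in \<open>simp_all add: sact_elementary_closed\<close>)
  show ?thesis
    unfolding simplicial_abelian_group_def carrier_elementary using comm hom ident comp by blast
qed

section \<open>Projections onto the summands\<close>

definition component ::
    "nat \<Rightarrow> nat \<Rightarrow> (nat set \<Rightarrow> 'a::ab_group_add) \<Rightarrow> nat \<times> (nat \<Rightarrow> nat) \<Rightarrow> 'a" where
  "component m k f = (SOME x. (\<forall>i. x i \<in> surj_family {i, Suc i} m) \<and>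
    (\<forall>N\<ge>m. \<forall>T\<in>Sub m. f T = (\<Sum>i\<le>N. subset_fun m i (x i) T))) k"

lemma component_decomposition:
  obtains x where "\<And>i. x i \<in> surj_family {i, Suc i} m"
    "\<And>N T. m \<le> N \<Longrightarrow> T \<in> Sub m \<Longrightarrow> f T = (\<Sum>i\<le>N. subset_fun m i (x i) T)"
    "\<And>k. component m k f = x k"
  using someI_ex[OF subset_fun_decomposition[of m f]] unfolding component_def by blast

text \<open>Uniqueness of coefficients makes the choice in \<open>component\<close>
  harmless.\<close>

lemma component_eqI:
  assumes x: "\<And>i. x i \<in> surj_family {i, Suc i} m" and N: "m \<le> N" "k \<le> N"
    and f: "\<And>T. T \<in> Sub m \<Longrightarrow> f T = (\<Sum>i\<le>N. subset_fun m i (x i) T)"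
  shows "component m k f = x k"
proof -
  obtain x' where x': "\<And>i. x' i \<in> surj_family {i, Suc i} m"
    "\<And>N T. m \<le> N \<Longrightarrow> T \<in> Sub m \<Longrightarrow> f T = (\<Sum>i\<le>N. subset_fun m i (x' i) T)"
    "\<And>k. component m k f = x' k"
    using component_decomposition[of m f] by blast
  have "x' k = x k"
    by (rule subset_fun_inject[of "{..N}" x' m x k]) (use x x'(1,2) f N in auto)
  then show ?thesis using x'(3) by simp
qed

text \<open>So \<open>component\<close> is a retraction of the embedding: the family equal to
  \<open>y\<close> at \<open>k\<close> and zero elsewhere is a decomposition.\<close>

lemma component_subset_fun:
  assumes y: "y \<in> surj_family {k, Suc k} m" and f: "\<And>T. T \<in> Sub m \<Longrightarrow> f T = subset_fun m k y T"
  shows "component m k f = y"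
proof -
  define x where "x i = (if i = k then y else (\<lambda>z\<in>delta_surj m. 0))" for i
  have "(\<Sum>i\<le>m + k. subset_fun m i (x i) T) = subset_fun m k y T" for T
  proof -
    have "(\<Sum>i\<le>m + k. subset_fun m i (x i) T) = (\<Sum>i\<le>m + k. if i = k then subset_fun m k y T else 0)"
      by (intro sum.cong) (auto simp: x_def subset_fun_zero)
    then show ?thesis by simp
  qed
  moreover have "x i \<in> surj_family {i, Suc i} m" for i
    using y by (simp add: x_def zero_in_surj_family)
  ultimately have "component m k f = x k"
    using f by (intro component_eqI[of x m "m + k"]) auto
  then show ?thesis by (simp add: x_def)
qed

text \<open>Acting on every component of \<open>f\<close> yields a decomposition of the pulled-back
  function, and decompositions are unique.\<close>

lemma component_natural:
  assumes \<sigma>: "\<sigma> \<in> delta_hom l m" and f: "\<And>T. T \<in> Sub l \<Longrightarrow> g T = f (\<sigma> ` T)"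
  shows "component l k g = sact (elementary k) l m \<sigma> (component m k f)"
proof -
  obtain x where x: "\<And>i. x i \<in> surj_family {i, Suc i} m"
    "\<And>N T. m \<le> N \<Longrightarrow> T \<in> Sub m \<Longrightarrow> f T = (\<Sum>i\<le>N. subset_fun m i (x i) T)"
    "\<And>k. component m k f = x k"
    using component_decomposition[of m f] by blast
  \<comment> \<open>The range is at least \<open>m\<close> to decompose \<open>f\<close>, and at
    least \<open>l\<close> and \<open>k\<close> for uniqueness in degree \<open>l\<close>.\<close>
  have "g T = (\<Sum>i\<le>l + m + k. subset_fun l i (sact (elementary i) l m \<sigma> (x i)) T)" if T: "T \<in> Sub l" for T
  proof -
    have "T \<subseteq> {..l}" using T by (simp add: Sub_def)
    then show ?thesis
      using f[OF T] x(2)[OF _ image_in_Sub[OF \<sigma> T], of "l + m + k"]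
      by (simp add: subset_fun_natural[OF x(1) \<sigma>])
  qed
  then have "component l k g = sact (elementary k) l m \<sigma> (x k)"
    by (intro component_eqI[of _ l "l + m + k"]) (auto simp: sact_elementary_closed x(1))
  then show ?thesis by (simp add: x(3))
qed

text \<open>The functions on nonempty subsets are contracted by \<open>f \<mapsto> (T \<mapsto> f (T \<inter> \<tau>\<inverse>(0)))\<close>, with
  value \<open>0\<close> where the intersection is empty; the direct summand \<open>E(A, k)\<close> inherits this.\<close>

lemma contractible_elementary: "contractible (elementary k :: (nat \<times> (nat \<Rightarrow> nat) \<Rightarrow> 'a::ab_group_add) simp_group)"
proof -
  let ?E = "elementary k :: (nat \<times> (nat \<Rightarrow> nat) \<Rightarrow> 'a) simp_group"
  define cut where "cut m (y :: nat \<times> (nat \<Rightarrow> nat) \<Rightarrow> 'a) \<tau> T =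
    (if T \<inter> {t. \<tau> t = 0} = {} then 0 else subset_fun m k y (T \<inter> {t. \<tau> t = 0}))"
    for m and y and \<tau> :: "nat \<Rightarrow> nat" and T
  define H where "H m y \<tau> = component m k (cut m y \<tau>)" for m y \<tau>
  have closed: "H m y \<tau> \<in> surj_family {k, Suc k} m" for m y \<tau>
    using component_decomposition[of m "cut m y \<tau>"] unfolding H_def by metis
  have natural: "H l (sact ?E l m \<sigma> y) (compose {..l} \<tau> \<sigma>) = sact ?E l m \<sigma> (H m y \<tau>)"
    if \<sigma>: "\<sigma> \<in> delta_hom l m" and y: "y \<in> surj_family {k, Suc k} m" for l m \<sigma> y \<tau>
    unfolding H_def
  proof (rule component_natural[OF \<sigma>])
    fix T assume "T \<in> Sub l"
    then have T: "T \<subseteq> {..l}" by (simp add: Sub_def)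
    \<comment> \<open>Direct images commute with the cutting, which makes the homotopy
      simplicial.\<close>
    then have *: "\<sigma> ` (T \<inter> {t. compose {..l} \<tau> \<sigma> t = 0}) = \<sigma> ` T \<inter> {t. \<tau> t = 0}"
      by (auto simp: compose_def)
    have "T \<inter> {t. compose {..l} \<tau> \<sigma> t = 0} \<subseteq> {..l}" using T by blast
    from subset_fun_natural[OF y \<sigma> this]
    show "cut l (sact ?E l m \<sigma> y) (compose {..l} \<tau> \<sigma>) T = cut m y \<tau> (\<sigma> ` T)"
      unfolding cut_def *[symmetric] image_is_empty by simp
  qed
  have start: "H m y (\<lambda>i\<in>{..m}. 0) = y" if "y \<in> surj_family {k, Suc k} m" for m y
    unfolding H_def
  proof (rule component_subset_fun[OF that])
    fix T assume "T \<in> Sub m"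
    then have "T \<inter> {t. (\<lambda>i\<in>{..m}. 0 :: nat) t = 0} = T" "T \<noteq> {}" by (auto simp: Sub_def)
    then show "cut m y (\<lambda>i\<in>{..m}. 0) T = subset_fun m k y T" by (simp only: cut_def if_False)
  qed
  define v :: "nat \<times> (nat \<Rightarrow> nat) \<Rightarrow> 'a" where "v = (\<lambda>z\<in>delta_surj 0. 0)"
  have v: "v \<in> surj_family {k, Suc k} 0" by (simp add: v_def zero_in_surj_family)
  \<comment> \<open>For constant \<open>\<tau>\<close> with value 1 everything is cut away, so the
    homotopy ends at the zero vertex.\<close>
  have stop: "H m y (\<lambda>i\<in>{..m}. 1) = sact ?E m 0 (\<lambda>i\<in>{..m}. 0) v" for m y
    unfolding H_def
  proof (rule component_subset_fun[OF sact_elementary_closed[OF v]])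
    fix T assume "T \<in> Sub m"
    then have T: "T \<subseteq> {..m}" "T \<inter> {t. (\<lambda>i\<in>{..m}. 1 :: nat) t = 0} = {}" by (auto simp: Sub_def)
    have "(\<lambda>i\<in>{..m}. 0) \<in> delta_hom m 0" by (auto simp: delta_hom_def monotone_on_def)
    from subset_fun_natural[OF v this T(1)]
    show "cut m y (\<lambda>i\<in>{..m}. 1) T = subset_fun m k (sact ?E m 0 (\<lambda>i\<in>{..m}. 0) v) T"
      using T(2) by (simp only: cut_def if_True simp_thms v_def subset_fun_zero)
  qed
  show ?thesis
    unfolding contractible_def carrier_elementary
    using closed natural start stop v by blast
qed


section \<open>The functor \<open>K\<^sup>*\<close> on polynomial cubes\<close>

definition cubewise :: "nat \<Rightarrow> (nat set \<Rightarrow> 'a) \<Rightarrow> nat \<Rightarrow> ((nat \<Rightarrow> int) \<Rightarrow> nat set) \<Rightarrow> (nat \<Rightarrow> int) \<Rightarrow> 'a" where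
  "cubewise m f = (\<lambda>l. \<lambda>c\<in>K_cubes m l. \<lambda>x\<in>cube l. f (c x))"

lemma cubewise_cong:
  assumes "\<And>T. T \<in> Sub m \<Longrightarrow> f T = g T" shows "cubewise m f = cubewise m g"
  unfolding cubewise_def using K_cubes_Sub assms by (intro ext restrict_ext) blast

lemma point_box_hom:
  assumes "x \<in> cube l" shows "(\<lambda>y\<in>cube 0. x) \<in> box_hom 0 l"
  using assms unfolding box_hom_def by (intro CollectI conjI exI[of _ x] exI[of _ "\<lambda>_ _. 0"]) auto

text \<open>A constant labelling of the \<open>m\<close>-cube is degenerable, so each element of
  \<open>Sub m\<close> is a vertex, at which \<open>cubewise m f\<close> can be evaluated.\<close>

lemma constant_K_cube:
  assumes "T \<in> Sub m" shows "(\<lambda>x\<in>cube 0. T) \<in> K_cubes m 0"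
proof -
  have B: "(\<lambda>x\<in>cube m. T) \<in> degenerable m" using assms by (auto simp: degenerable_def)
  have id: "(\<lambda>i\<in>{..m}. i) \<in> delta_hom m m" by (auto simp: delta_hom_def monotone_on_def)
  have "(\<lambda>i\<in>{..m}. i) ` T = (\<lambda>i. i) ` T" using assms by (intro image_cong) (auto simp: Sub_def)
  then have "(\<lambda>x\<in>cube 0. T) = (\<lambda>y\<in>cube 0. (\<lambda>i\<in>{..m}. i) ` (\<lambda>x\<in>cube m. T) ((\<lambda>y\<in>cube 0. vertex m {}) y))"
    by (intro restrict_ext) (simp add: vertex_in_cube)
  then show ?thesis
    using B id point_box_hom[OF vertex_in_cube] unfolding K_cubes_def by blast
qed

lemma cubewise_inject:
  assumes "cubewise m f = cubewise m g" "T \<in> Sub m" shows "f T = g T"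
proof -
  have "cubewise m f 0 (\<lambda>x\<in>cube 0. T) (vertex 0 {}) = cubewise m g 0 (\<lambda>x\<in>cube 0. T) (vertex 0 {})"
    using assms(1) by simp
  then show ?thesis using constant_K_cube[OF assms(2)] by (simp add: cubewise_def vertex_in_cube)
qed

lemma cubewise_in_K_star:
  assumes f: "\<And>l c. c \<in> K_cubes m l \<Longrightarrow> (\<lambda>x\<in>cube l. f (c x)) \<in> low_degree (Suc n) l"
  shows "cubewise m f \<in> carrier (sgrp (K_star (poly_cubegroup n)) m)"
proof -
  have "cubewise m f l \<in> K_cubes m l \<rightarrow>\<^sub>E poly_cubes n l" for l
    using f by (simp add: cubewise_def poly_cubes_eq_low_degree PiE_iff)
  moreover have "cubewise m f l (compose (cube l) c \<phi>) = compose (cube l) (cubewise m f j c) \<phi>"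
    if \<phi>: "\<phi> \<in> box_hom l j" and c: "c \<in> K_cubes m j" for l j \<phi> c
  proof -
    have "compose (cube l) c \<phi> \<in> K_cubes m l"
      using is_cubeset_K[of m] \<phi> c by (auto simp: is_cubeset_def K_cubeset_def)
    moreover have "\<phi> x \<in> cube j" if "x \<in> cube l" for x using \<phi> that by (auto simp: box_hom_def)
    ultimately show ?thesis using c by (auto simp: cubewise_def compose_def fun_eq_iff)
  qed
  ultimately show ?thesis
    by (simp add: K_star_def cubeset_hom_def K_cubeset_def poly_cubegroup_def)
qed

text \<open>A polynomial cube is determined by its vertices, so a map of cubesets is determined by
  its values on the \<open>0\<close>-cubes of \<open>K\<^sub>m\<close>, which are the elements of \<open>Sub m\<close>.\<close>

lemma K_star_cubewise:
  assumes F: "F \<in> carrier (sgrp (K_star (poly_cubegroup n)) m)"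
  obtains f where "F = cubewise m f"
    "\<And>l c. c \<in> K_cubes m l \<Longrightarrow> (\<lambda>x\<in>cube l. f (c x)) \<in> low_degree (Suc n) l"
proof
  define f where "f T = F 0 (\<lambda>x\<in>cube 0. T) (vertex 0 {})" for T
  have F1: "F l \<in> K_cubes m l \<rightarrow>\<^sub>E low_degree (Suc n) l" for l
    using F by (simp add: K_star_def cubeset_hom_def K_cubeset_def poly_cubegroup_def poly_cubes_eq_low_degree)
  have F2: "F l (compose (cube l) c \<phi>) = compose (cube l) (F j c) \<phi>"
    if "\<phi> \<in> box_hom l j" "c \<in> K_cubes m j" for l j \<phi> c
    using F that by (simp add: K_star_def cubeset_hom_def K_cubeset_def poly_cubegroup_def)
  have val: "F l c = (\<lambda>x\<in>cube l. f (c x))" if c: "c \<in> K_cubes m l" for l c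
  proof (rule extensionalityI[of _ "cube l"])
    have "F l c \<in> low_degree (Suc n) l" using F1 c by blast
    then show "F l c \<in> extensional (cube l)" by (auto simp: low_degree_def)
    fix x assume x: "x \<in> cube l"
    have "compose (cube 0) c (\<lambda>y\<in>cube 0. x) = (\<lambda>y\<in>cube 0. c x)"
      by (auto simp: compose_def fun_eq_iff)
    then have "f (c x) = compose (cube 0) (F l c) (\<lambda>y\<in>cube 0. x) (vertex 0 {})"
      using F2[OF point_box_hom[OF x] c] by (simp add: f_def)
    then show "F l c x = (\<lambda>x\<in>cube l. f (c x)) x"
      using x by (simp add: compose_def vertex_in_cube)
  qed simp
  show "F = cubewise m f"
  proof (intro ext)
    fix l c x show "F l c x = cubewise m f l c x"
      using val[of c l] F1[of l]
      by (cases "c \<in> K_cubes m l") (auto simp: cubewise_def PiE_iff extensional_def)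
  qed
  show "(\<lambda>x\<in>cube l. f (c x)) \<in> low_degree (Suc n) l" if "c \<in> K_cubes m l" for l c
    using val[OF that] F1[of l] that by (metis PiE_mem)
qed

text \<open>A term with \<open>p \<in> P\<close> factors through \<open>Sub p\<close> and so has
  degree at most \<open>p\<close>, hence at most \<open>n\<close>; all other coefficients are
  zero.\<close>

lemma subset_fun_low_degree:
  assumes y: "y \<in> surj_family P m" "P \<subseteq> {..n}" and c: "c \<in> K_cubes m l"
  shows "(\<lambda>x\<in>cube l. subset_fun m k y (c x)) \<in> low_degree (Suc n) l"
  unfolding subset_fun_def
proof (rule low_degree_sum)
  fix z assume z: "z \<in> delta_surj m"
  obtain p \<eta> where zeq: "z = (p, \<eta>)" by force
  show "(\<lambda>x\<in>cube l. case z of (p, \<eta>) \<Rightarrow> if hits k p (\<eta> ` c x) then y (p, \<eta>) else 0) \<in> low_degree (Suc n) l"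
  proof (cases "p \<in> P")
    case True
    then have "Suc p \<le> Suc n" using y(2) by auto
    moreover have "\<eta> \<in> delta_hom m p" using z zeq delta_surjD(1) by blast
    ultimately show ?thesis
      using K_cube_low_degree[OF _ c, of \<eta> p "\<lambda>W. if hits k p W then y (p, \<eta>) else 0"]
        low_degree_mono[THEN subsetD, of "Suc p" "Suc n"] unfolding zeq prod.case by blast
  next
    case False
    then have "y (p, \<eta>) = 0" using y(1) z zeq by (simp add: surj_family_def)
    then show ?thesis using low_degree_zero[of l "Suc n"] by (simp only: zeq prod.case if_cancel)
  qed
qed

text \<open>The two complexes differ only in degree \<open>n + 1\<close> and its differential, where
  \<open>y\<close> vanishes. This lets \<open>K(A, n)\<close> share the embedding of
  \<open>E(A, n)\<close>.\<close>

lemma sact_eilenberg_maclane: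
  assumes y: "y \<in> surj_family {n} m"
  shows "sact (eilenberg_maclane n) l m \<alpha> y = sact (elementary n) l m \<alpha> y"
  unfolding eilenberg_maclane_def concentrated_eq elementary_def
proof (rule extensionalityI[OF sact_extensional sact_extensional])
  fix z assume z: "z \<in> delta_surj l"
  obtain q \<theta> where zeq: "z = (q, \<theta>)" by force
  have y': "y \<in> surj_family {n, Suc n} m" using y by (auto simp: surj_family_def)
  have "identity_coeff {} q p \<mu> (y (p, \<eta>)) = identity_coeff {Suc n} q p \<mu> (y (p, \<eta>))"
    if "(p, \<eta>, \<mu>) \<in> factorisations l m \<alpha> (q, \<theta>)" for p \<eta> \<mu>
    using that y by (auto simp: identity_coeff_def factorisations_def surj_family_def)
  then show "sact (dold_kan (identity_complex {n} {})) l m \<alpha> y z =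
      sact (dold_kan (identity_complex {n, Suc n} {Suc n})) l m \<alpha> y z"
    using sact_identity_complex[of y "{n}" m "{}" q \<theta> l \<alpha>] z
      sact_identity_complex[of y "{n, Suc n}" m "{Suc n}" q \<theta> l \<alpha>] y y'
    by (auto simp: zeq intro!: sum.cong)
qed

section \<open>Assembly of the isomorphism\<close>

lemma simp_group_iso_by_inverse:
  assumes iso: "\<And>m. \<Psi> m \<in> iso (sgrp Y m) (sgrp X m)" and grp: "\<And>m. group (sgrp Y m)"
    and closed: "\<And>l m \<sigma> y. \<sigma> \<in> delta_hom l m \<Longrightarrow> y \<in> carrier (sgrp Y m) \<Longrightarrow> sact Y l m \<sigma> y \<in> carrier (sgrp Y l)"
    and natural: "\<And>l m \<sigma> y. \<sigma> \<in> delta_hom l m \<Longrightarrow> y \<in> carrier (sgrp Y m) \<Longrightarrow>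
      \<Psi> l (sact Y l m \<sigma> y) = sact X l m \<sigma> (\<Psi> m y)"
  shows "simp_group_iso X Y"
  unfolding simp_group_iso_def
proof (intro exI conjI allI ballI)
  let ?\<Phi> = "\<lambda>m. inv_into (carrier (sgrp Y m)) (\<Psi> m)"
  show "?\<Phi> m \<in> iso (sgrp X m) (sgrp Y m)" for m
    using group.iso_set_sym[OF grp iso] .
  fix l m \<sigma> x assume \<sigma>: "\<sigma> \<in> delta_hom l m" and x: "x \<in> carrier (sgrp X m)"
  have bij: "bij_betw (\<Psi> m) (carrier (sgrp Y m)) (carrier (sgrp X m))" for m
    using iso by (simp add: iso_def)
  define y where "y = ?\<Phi> m x"
  have y: "y \<in> carrier (sgrp Y m)" "\<Psi> m y = x"
    using bij_betw_inv_into_right[OF bij x] bij_betw_apply[OF bij_betw_inv_into[OF bij] x]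
    by (simp_all add: y_def)
  show "?\<Phi> l (sact X l m \<sigma> x) = sact Y l m \<sigma> (?\<Phi> m x)"
    using bij_betw_inv_into_left[OF bij closed[OF \<sigma> y(1)]] natural[OF \<sigma> y(1)] y(2)
    by (simp add: y_def)
qed

lemma group_elementary: "group (sgrp (elementary k) m)"
  unfolding elementary_def by (rule comm_group.axioms(2)[OF comm_group_dold_kan_identity_complex])

text \<open>The explicit map runs from the sum to \<open>K_star\<close> and adds up the subset
  functions of the components. The degree bound puts it into polynomial cubes, uniqueness of
  coefficients makes it injective, and decomposition together with vanishing above degree
  \<open>n\<close> makes it surjective.\<close>

lemma K_star_poly_iso:
  "simp_group_iso (K_star (poly_cubegroup n :: ((nat \<Rightarrow> int) \<Rightarrow> 'a::ab_group_add) cubegroup))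
     (simp_binary_sum (simp_direct_sum {..<n} (elementary :: nat \<Rightarrow> (nat \<times> (nat \<Rightarrow> nat) \<Rightarrow> 'a) simp_group))
       (eilenberg_maclane n :: (nat \<times> (nat \<Rightarrow> nat) \<Rightarrow> 'a) simp_group))"
proof -
  let ?X = "K_star (poly_cubegroup n :: ((nat \<Rightarrow> int) \<Rightarrow> 'a) cubegroup)"
  let ?Y = "simp_binary_sum (simp_direct_sum {..<n} (elementary :: nat \<Rightarrow> (nat \<times> (nat \<Rightarrow> nat) \<Rightarrow> 'a) simp_group))
    (eilenberg_maclane n :: (nat \<times> (nat \<Rightarrow> nat) \<Rightarrow> 'a) simp_group)"
  define fn where "fn m = (\<lambda>(e :: nat \<Rightarrow> nat \<times> (nat \<Rightarrow> nat) \<Rightarrow> 'a, y) T.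
    (\<Sum>i<n. subset_fun m i (e i) T) + subset_fun m n y T)" for m
  define \<Psi> where "\<Psi> m z = cubewise m (fn m z)" for m z
  have carrier_EM: "carrier (sgrp (eilenberg_maclane n) m) = surj_family {n} m" for m
    by (simp add: eilenberg_maclane_def concentrated_eq carrier_dold_kan_identity_complex)
  have carrier_Y: "carrier (sgrp ?Y m) = (\<Pi>\<^sub>E i\<in>{..<n}. surj_family {i, Suc i} m) \<times> surj_family {n} m" for m
    by (simp add: simp_binary_sum_def simp_direct_sum_def carrier_EM carrier_elementary
        carrier_sum_group[OF group_elementary])
  have group_Y: "group (sgrp ?Y m)" for m
    by (simp add: simp_binary_sum_def simp_direct_sum_def eilenberg_maclane_def concentrated_eq
        DirProd_group group_elementary comm_group.axioms(2)[OF comm_group_dold_kan_identity_complex])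
  have widen: "y \<in> surj_family {n, Suc n} m" if "y \<in> surj_family {n} m" for m and y :: "_ \<Rightarrow> 'a"
    using that by (auto simp: surj_family_def)
  have closed: "sact ?Y l m \<sigma> z \<in> carrier (sgrp ?Y l)" if "z \<in> carrier (sgrp ?Y m)" for l m \<sigma> z
  proof -
    obtain e y where [simp]: "z = (e, y)" by force
    have "sact (eilenberg_maclane n) l m \<sigma> y \<in> surj_family {n} l"
      unfolding eilenberg_maclane_def concentrated_eq
      by (rule sact_in_surj_family) (use that carrier_Y in auto)
    then show ?thesis
      using that unfolding carrier_Y
      by (auto simp: simp_binary_sum_def simp_direct_sum_def PiE_iff sact_elementary_closed)
  qed
  have natural: "\<Psi> l (sact ?Y l m \<sigma> z) = sact ?X l m \<sigma> (\<Psi> m z)"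
    if \<sigma>: "\<sigma> \<in> delta_hom l m" and z: "z \<in> carrier (sgrp ?Y m)" for l m \<sigma> z
  proof -
    obtain e y where zeq: "z = (e, y)" by force
    have e: "e i \<in> surj_family {i, Suc i} m" if "i < n" for i
      using z that unfolding carrier_Y zeq by auto
    have y: "y \<in> surj_family {n} m" using z unfolding carrier_Y zeq by simp
    have "fn l (sact ?Y l m \<sigma> z) T = fn m z (\<sigma> ` T)" if "T \<in> Sub l" for T
    proof -
      have "T \<subseteq> {..l}" using that by (simp add: Sub_def)
      then show ?thesis
        using e y widen[OF y] \<sigma>
        by (auto simp: fn_def zeq simp_binary_sum_def simp_direct_sum_def sact_eilenberg_maclane
            subset_fun_natural intro!: sum.cong)
    qed
    then have "\<Psi> l (sact ?Y l m \<sigma> z) = cubewise l (\<lambda>T. fn m z (\<sigma> ` T))"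
      unfolding \<Psi>_def by (rule cubewise_cong)
    also have "\<dots> = sact ?X l m \<sigma> (\<Psi> m z)"
      using K_cubes_image[OF \<sigma>] by (auto simp: K_star_def \<Psi>_def cubewise_def intro!: ext)
    finally show ?thesis .
  qed
  \<comment> \<open>The Eilenberg-Mac Lane part becomes the summand of index \<open>n\<close>, so
    that the results on families indexed by \<open>{..n}\<close> apply.\<close>
  have fn_atMost: "fn m (e, y) T = (\<Sum>i\<le>n. subset_fun m i (if i < n then e i else y) T)" for m e y T
    by (simp add: fn_def lessThan_Suc_atMost[symmetric])
  have into: "\<Psi> m z \<in> carrier (sgrp ?X m)" if z: "z \<in> carrier (sgrp ?Y m)" for m z
    unfolding \<Psi>_def
  proof (rule cubewise_in_K_star)
    obtain e y where zeq: "z = (e, y)" by force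
    fix l c assume c: "c \<in> K_cubes m l"
    have "(\<lambda>x\<in>cube l. \<Sum>i\<le>n. subset_fun m i (if i < n then e i else y) (c x)) \<in> low_degree (Suc n) l"
    proof (rule low_degree_sum)
      fix i assume "i \<in> {..n}"
      have "(if i < n then e i else y) \<in> surj_family (if i < n then {i, Suc i} else {n}) m"
        using z unfolding carrier_Y zeq by auto
      then show "(\<lambda>x\<in>cube l. subset_fun m i (if i < n then e i else y) (c x)) \<in> low_degree (Suc n) l"
        using c by (intro subset_fun_low_degree) (auto split: if_splits)
    qed
    then show "(\<lambda>x\<in>cube l. fn m z (c x)) \<in> low_degree (Suc n) l"
      by (simp only: zeq fn_atMost)
  qed
  have hom: "\<Psi> m \<in> hom (sgrp ?Y m) (sgrp ?X m)" for m
  proof (rule homI[OF into])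
    fix z z' assume z: "z \<in> carrier (sgrp ?Y m)" and z': "z' \<in> carrier (sgrp ?Y m)"
    obtain e y e' y' where zeq: "z = (e, y)" "z' = (e', y')" by (metis prod.exhaust)
    have e: "e i \<in> surj_family {i, Suc i} m" "e' i \<in> surj_family {i, Suc i} m" if "i < n" for i
      using z z' that unfolding carrier_Y zeq by auto
    have y: "y \<in> surj_family {n} m" "y' \<in> surj_family {n} m"
      using z z' unfolding carrier_Y zeq by auto
    have "z \<otimes>\<^bsub>sgrp ?Y m\<^esub> z' =
        (\<lambda>i\<in>{..<n}. \<lambda>w\<in>delta_surj m. e i w + e' i w, \<lambda>w\<in>delta_surj m. y w + y' w)"
      using e y by (auto simp: zeq simp_binary_sum_def simp_direct_sum_def eilenberg_maclane_def
          concentrated_eq elementary_def mult_dold_kan_identity_complex intro!: restrict_ext)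
    then have "fn m (z \<otimes>\<^bsub>sgrp ?Y m\<^esub> z') T = fn m z T + fn m z' T" for T
      by (simp add: fn_def zeq subset_fun_add sum.distrib algebra_simps)
    then show "\<Psi> m (z \<otimes>\<^bsub>sgrp ?Y m\<^esub> z') = \<Psi> m z \<otimes>\<^bsub>sgrp ?X m\<^esub> \<Psi> m z'"
      by (auto simp: \<Psi>_def cubewise_def K_star_def poly_cubegroup_def fun_eq_iff)
  qed
  have inj: "inj_on (\<Psi> m) (carrier (sgrp ?Y m))" for m
  proof (rule inj_onI)
    fix z z' assume z: "z \<in> carrier (sgrp ?Y m)" "z' \<in> carrier (sgrp ?Y m)" and eq: "\<Psi> m z = \<Psi> m z'"
    obtain e y e' y' where zeq: "z = (e, y)" "z' = (e', y')" by (metis prod.exhaust)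
    have fam: "(if i < n then e i else y) \<in> surj_family {i, Suc i} m"
      "(if i < n then e' i else y') \<in> surj_family {i, Suc i} m" if "i \<in> {..n}" for i
      using z that widen[of y m] widen[of y' m] unfolding carrier_Y zeq by auto
    have "(\<Sum>i\<le>n. subset_fun m i (if i < n then e i else y) T) =
        (\<Sum>i\<le>n. subset_fun m i (if i < n then e' i else y') T)" if "T \<in> Sub m" for T
      using cubewise_inject[OF eq[unfolded \<Psi>_def] that] by (simp only: zeq fn_atMost)
    from subset_fun_inject[OF _ fam this]
    have *: "(if i < n then e i else y) = (if i < n then e' i else y')" if "i \<le> n" for i
      using that by auto
    have "e = e'"
      using z unfolding carrier_Y zeq
      by (intro extensionalityI[of e "{..<n}" e']) (use * in \<open>auto simp: PiE_iff, meson less_imp_le\<close>)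
    then show "z = z'" using *[of n] zeq by simp
  qed
  have surj: "\<exists>z\<in>carrier (sgrp ?Y m). F = \<Psi> m z" if X: "F \<in> carrier (sgrp ?X m)" for m F
  proof -
    obtain f where F: "F = cubewise m f"
      and f: "\<And>l c. c \<in> K_cubes m l \<Longrightarrow> (\<lambda>x\<in>cube l. f (c x)) \<in> low_degree (Suc n) l"
      using K_star_cubewise[OF X] by blast
    obtain x where x: "\<And>i. x i \<in> surj_family {i, Suc i} m"
      and fx: "\<And>N T. m \<le> N \<Longrightarrow> T \<in> Sub m \<Longrightarrow> f T = (\<Sum>i\<le>N. subset_fun m i (x i) T)"
      using subset_fun_decomposition[of m f] by blast
    \<comment> \<open>On a \<open>p\<close>-cube with \<open>p > n\<close> the function has degree
      at most \<open>n\<close>, hence less than \<open>p\<close>, which is the input of the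
      vanishing result.\<close>
    have vanish: "x i (p, \<eta>) = 0" if "i \<le> m + n" "(p, \<eta>) \<in> delta_surj m" "n < p" for i p \<eta>
    proof (rule coefficients_vanish[of "{..m + n}" x m "{n<..}" i p \<eta>])
      fix p B \<sigma> assume p: "p \<in> {n<..}" and B: "B \<in> degenerable p" and \<sigma>: "\<sigma> \<in> delta_hom p m"
      have c: "(\<lambda>u\<in>cube p. \<sigma> ` B u) \<in> K_cubes m p" by (rule image_degenerable_in_K_cubes[OF B \<sigma>])
      have "(\<lambda>u\<in>cube p. \<Sum>i\<le>m + n. subset_fun m i (x i) (\<sigma> ` B u)) =
          (\<lambda>u\<in>cube p. f ((\<lambda>u\<in>cube p. \<sigma> ` B u) u))"
        using fx[of "m + n"] K_cubes_Sub[OF c] by (intro restrict_ext) simp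
      also have "\<dots> \<in> low_degree p p"
        using f[OF c] low_degree_mono[of "Suc n" p p] p by auto
      finally show "(\<lambda>u\<in>cube p. \<Sum>i\<le>m + n. subset_fun m i (x i) (\<sigma> ` B u)) \<in> low_degree p p" .
    qed (use x that in auto)
    \<comment> \<open>For \<open>i > n\<close> both degrees of the summand exceed
      \<open>n\<close>.\<close>
    have high: "subset_fun m i (x i) T = 0" if "i \<in> {..m + n} - {..n}" for i T
      unfolding subset_fun_def using that vanish[of i] x[of i]
      by (intro sum.neutral) (auto simp: hits_def)
    have "f T = fn m (\<lambda>i\<in>{..<n}. x i, x n) T" if "T \<in> Sub m" for T
    proof -
      have "f T = (\<Sum>i\<le>m + n. subset_fun m i (x i) T)" using fx[of "m + n"] that by simp
      also have "\<dots> = (\<Sum>i\<le>n. subset_fun m i (x i) T)"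
        using high by (intro sum.mono_neutral_right) auto
      also have "\<dots> = fn m (\<lambda>i\<in>{..<n}. x i, x n) T"
        unfolding fn_atMost by (intro sum.cong) (auto simp: le_less)
      finally show ?thesis .
    qed
    then have "F = \<Psi> m (\<lambda>i\<in>{..<n}. x i, x n)"
      unfolding F \<Psi>_def by (rule cubewise_cong)
    \<comment> \<open>In the summand of index \<open>n\<close> only degree \<open>n + 1\<close> is
      lost, and what remains is \<open>K(A, n)\<close>.\<close>
    moreover have "x n \<in> surj_family {n} m"
      using x[of n] vanish[of n "Suc n"] by (auto simp: surj_family_def)
    then have "(\<lambda>i\<in>{..<n}. x i, x n) \<in> carrier (sgrp ?Y m)"
      unfolding carrier_Y using x by auto
    ultimately show ?thesis by blast
  qed
  have "\<Psi> m ` carrier (sgrp ?Y m) = carrier (sgrp ?X m)" for m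
    using into surj by (intro equalityI subsetI) blast+
  then have "\<Psi> m \<in> iso (sgrp ?Y m) (sgrp ?X m)" for m
    using hom inj by (simp add: iso_def bij_betw_def)
  then show ?thesis
    using group_Y closed natural by (intro simp_group_iso_by_inverse)
qed

theorem mainTheorem8:
  shows "\<exists>E :: nat \<Rightarrow> (nat \<times> (nat \<Rightarrow> nat) \<Rightarrow> 'a::ab_group_add) simp_group.
    (\<forall>k. simplicial_abelian_group (E k) \<and> contractible (E k)) \<and>
    (\<forall>n. simp_group_iso
       (K_star (poly_cubegroup n :: ((nat \<Rightarrow> int) \<Rightarrow> 'a) cubegroup))
       (simp_binary_sum (simp_direct_sum {..<n} E)
          (eilenberg_maclane n :: (nat \<times> (nat \<Rightarrow> nat) \<Rightarrow> 'a) simp_group)))"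
  using simplicial_abelian_group_elementary contractible_elementary K_star_poly_iso
  by (intro exI[of _ elementary]) blast

end
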